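(* Let $Z:\mathfrak{H}^0\to\mathbb{R}$ be a $\mathbb{Q}$-linear map satisfying the double shuffle relation. Then the following three properties of $Z$ are equivalent: (Reg) $Z_{\sqcup\!\sqcup}(\mathbf{k};T)=\rho_Z\bigl(Z_*(\mathbf{k};T)\bigr)$ for every index $\mathbf{k}$; (Reg$^\star$) $Z^\star_{\sqcup\!\sqcup}(\mathbf{k};T)=\rho^\star_Z\bigl(Z^\star_*(\mathbf{k};T)\bigr)$ for every index $\mathbf{k}$; (Int-Ser) $Z\bigl(\mu(\mathbf{k},\mathbf{l})\bigr)=Z\bigl(\mathbf{k}\circledast\mathbf{l}^\star\bigr)$ for all non-empty indices $\mathbf{k},\mathbf{l}$.
   Context: Let $\mathfrak{H}=\mathbb{Q}\langle e_0,e_1\rangle$, $\mathfrak{H}^1=\mathbb{Q}+e_1\mathfrak{H}$, $\mathfrak{H}^0=\mathbb{Q}+e_1\mathfrak{H}e_0$, $e_k=e_1e_0^{k-1}$ ($k\ge1$). An index is a finite (possibly empty) sequence $\mathbf{k}=(k_1,\dots,k_r)$ of positive integers, admissible if empty or $k_r\ge2$; indices are identified with words $e_{k_1}\cdots e_{k_r}$ (empty index $\leftrightarrow 1$), giving bases of $\mathfrak{H}^1$ resp. (admissible) $\mathfrak{H}^0$; maps on indices are extended $\mathbb{Q}$-linearly. Products: shuffle $\sqcup\!\sqcup$ on $\mathfrak{H}$ is $\mathbb{Q}$-bilinear with $1\sqcup\!\sqcup w=w\sqcup\!\sqcup 1=w$, $av\sqcup\!\sqcup bw=a(v\sqcup\!\sqcup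 bw)+b(av\sqcup\!\sqcup w)$ for $a,b\in\{e_0,e_1\}$; harmonic $*$ on $\mathfrak{H}^1$ with $1*w=w*1=w$, $e_kv*e_lw=e_k(v*e_lw)+e_l(e_kv*w)+e_{k+l}(v*w)$. $\mathfrak{H}^1,\mathfrak{H}^0$ are closed under both. $Z$ satisfies the double shuffle relation if $Z(v\sqcup\!\sqcup w)=Z(v*w)=Z(v)Z(w)$ for all $v,w\in\mathfrak{H}^0$. Then $Z_{\sqcup\!\sqcup},Z_*:\mathfrak{H}^1\to\mathbb{R}[T]$ are the unique $\mathbb{Q}$-algebra homomorphisms for $\sqcup\!\sqcup$, resp. $*$, extending $Z$ and sending $e_1\mapsto T$ (they exist since $\mathfrak{H}^1$ is the polynomial algebra over $\mathfrak{H}^0$ in $e_1$ for either product). Write $Z_\bullet(\mathbf{k};T)$ for the value on the word of $\mathbf{k}$. $\circledast:e_1\mathfrak{H}\times e_1\mathfrak{H}\to e_1\mathfrak{H}e_0$ is bilinear with $ve_k\circledast we_l=(v*w)e_{k+l}$. For non-empty $\mathbf{k}=(k_1,\dots,k_r)$, $\mathbf{k}^\star$ is the sum of the $2^{r-1}$ indices $(k_1\bigcirc\cdots\bigcirc k_r)$ with each $\bigcirc$ a comma or a plus sign; $\varnothing^\star=\varnothing$; extended linearly. A 2-poset is a finite poset $X$ with labels $\delta_X:X\to\{0,1\}$; $W(X)\in\mathfrak{H}$ is the sum over all linear extensions $x_1,\dots,x_n$ of the order of $e_{\delta_X(x_1)}\cdots e_{\delta_X(x_n)}$, $W(\emptyset)=1$.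 For non-empty $\mathbf{l}=(l_1,\dots,l_s)$ and $\delta\in\{0,1\}$, $P_\delta(\mathbf{l})$ is the 2-poset on elements $b_{j,i}$ ($1\le j\le s$, $1\le i\le l_j$) with order generated by $b_{j,1}<\cdots<b_{j,l_j}$ and $b_{j-1,1}<b_{j,l_j}$ ($2\le j\le s$), labels $\delta(b_{s,1})=\delta$, $\delta(b_{j,1})=1$ ($j<s$), $\delta(b_{j,i})=0$ ($i\ge2$); $P_1(\varnothing)=\emptyset$. For non-empty $\mathbf{k}$ of weight $K$ and non-empty $\mathbf{l}$, $\mu(\mathbf{k},\mathbf{l})=W(Q)$ where $Q$ is the disjoint union of a chain $a_1<\cdots<a_K$ (with $\delta(a_t)=1$ iff $t\in\{1,k_1+1,\dots,k_1+\dots+k_{r-1}+1\}$, else $0$) and $P_0(\mathbf{l})$, with the extra relation $a_K<b_{s,1}$. Star regularizations: $Z^\star_*(\mathbf{k};T)=Z_*(\mathbf{k}^\star;T)$ and $Z^\star_{\sqcup\!\sqcup}(\mathbf{k};T)=Z_{\sqcup\!\sqcup}\bigl(W(P_1(\mathbf{k}));T\bigr)$. Let $A_Z(u)=\exp\bigl(\sum_{n\ge2}\frac{(-1)^n}{n}Z(e_n)u^n\bigr)\in\mathbb{R}[[u]]$; $\rho_Z,\rho_Z^\star$ are the $\mathbb{R}$-linear maps on $\mathbb{R}[T]$ defined (coefficientwise in $u$) by $\rho_Z(e^{Tu})=A_Z(u)e^{Tu}$ and $\rho^\star_Z(e^{Tu})=A_Z(-u)^{-1}e^{Tu}$. *)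

theory Defs
  imports Complex_Main "HOL-Library.Poly_Mapping"
    "HOL-Computational_Algebra.Polynomial" "HOL-Computational_Algebra.Formal_Power_Series"
begin

text \<open>
  Lists form a monoid under concatenation, written additively so that the convolution product of
  \<^theory>\<open>HOL-Library.Poly_Mapping\<close> on finitely supported functions on words is the product of the
  free associative algebra.
\<close>

instantiation list :: (type) monoid_add
begin
definition "0 = []"
definition "xs + ys = xs @ ys"
instance by standard (simp_all add: zero_list_def plus_list_def)
end

datatype letter = E0 | E1

type_synonym ncpoly = "letter list \<Rightarrow>\<^sub>0 rat"

definition wd :: "letter list \<Rightarrow> ncpoly" where
  "wd w = Poly_Mapping.single w 1"

definition qsc :: "rat \<Rightarrow> ncpoly \<Rightarrow> ncpoly" where
  "qsc c p = Poly_Mapping.single [] c * p"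

definition H1 :: "ncpoly set" where
  "H1 = {qsc c 1 + wd [E1] * h | c h. True}"

definition H0 :: "ncpoly set" where
  "H0 = {qsc c 1 + wd [E1] * h * wd [E0] | c h. True}"

definition ee :: "nat \<Rightarrow> ncpoly" where
  "ee k = wd [E1] * wd [E0] ^ (k - 1)"

definition is_index :: "nat list \<Rightarrow> bool" where
  "is_index k \<longleftrightarrow> (\<forall>x\<in>set k. 1 \<le> x)"

definition ind :: "nat list \<Rightarrow> ncpoly" where
  "ind k = prod_list (map ee k)"

text \<open>
  The identification of words in \<open>H1\<close> with indices; see \<open>ind_index_of\<close> and \<open>index_of_ind\<close> below.
  The value on words beginning with \<^term>\<open>E0\<close> is irrelevant.
\<close>

function index_of :: "letter list \<Rightarrow> nat list" where
  "index_of [] = []"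
| "index_of (a # w) = Suc (length (takeWhile ((=) E0) w)) # index_of (dropWhile ((=) E0) w)"
  by pat_completeness auto
termination
  by (relation "measure length") (auto simp: le_imp_less_Suc length_dropWhile_le)

definition bilin :: "(letter list \<Rightarrow> letter list \<Rightarrow> ncpoly) \<Rightarrow> ncpoly \<Rightarrow> ncpoly \<Rightarrow> ncpoly" where
  "bilin f p q = (\<Sum>v\<in>Poly_Mapping.keys p. \<Sum>w\<in>Poly_Mapping.keys q.
     qsc (Poly_Mapping.lookup p v * Poly_Mapping.lookup q w) (f v w))"

fun shuffle_word :: "letter list \<Rightarrow> letter list \<Rightarrow> ncpoly" where
  "shuffle_word [] w = wd w"
| "shuffle_word v [] = wd v"
| "shuffle_word (a # v) (b # w) =
     wd [a] * shuffle_word v (b # w) + wd [b] * shuffle_word (a # v) w"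

definition shuffle :: "ncpoly \<Rightarrow> ncpoly \<Rightarrow> ncpoly" where
  "shuffle = bilin shuffle_word"

fun harmonic_ind :: "nat list \<Rightarrow> nat list \<Rightarrow> ncpoly" where
  "harmonic_ind [] l = ind l"
| "harmonic_ind k [] = ind k"
| "harmonic_ind (k # v) (l # w) =
     ee k * harmonic_ind v (l # w) + ee l * harmonic_ind (k # v) w + ee (k + l) * harmonic_ind v w"

text \<open>\<open>harmonic\<close> is meaningful on \<open>H1\<close> only, and \<open>circledast\<close> on the span of the words beginning
  with \<^term>\<open>E1\<close> only.\<close>

definition harmonic :: "ncpoly \<Rightarrow> ncpoly \<Rightarrow> ncpoly" where
  "harmonic = bilin (\<lambda>v w. harmonic_ind (index_of v) (index_of w))"

definition circledast :: "ncpoly \<Rightarrow> ncpoly \<Rightarrow> ncpoly" where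
  "circledast = bilin (\<lambda>v w. let k = index_of v; l = index_of w in
     harmonic_ind (butlast k) (butlast l) * ee (last k + last l))"

text \<open>The list, with multiplicities, of the indices obtained by replacing each comma of \<open>k\<close> by a
  comma or a plus sign.\<close>

fun merges :: "nat list \<Rightarrow> nat list list" where
  "merges [] = [[]]"
| "merges [k] = [[k]]"
| "merges (k # l # ks) = map ((#) k) (merges (l # ks)) @ merges ((k + l) # ks)"

definition star :: "nat list \<Rightarrow> ncpoly" where
  "star k = sum_list (map ind (merges k))"

text \<open>The field \<open>le\<close> is the reflexive order relation on the carrier.\<close>

record 'a labelled_poset =
  carr :: "'a set"
  le :: "('a \<times> 'a) set"
  lab :: "'a \<Rightarrow> letter"

definition two_poset :: "'a labelled_poset \<Rightarrow> bool" where
  "two_poset X \<longleftrightarrow> finite (carr X) \<and> partial_order_on (carr X) (le X)"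

definition generated_order :: "'a set \<Rightarrow> ('a \<times> 'a) set \<Rightarrow> ('a \<times> 'a) set" where
  "generated_order A r = Id_on A \<union> r\<^sup>+"

definition linear_extensions :: "'a labelled_poset \<Rightarrow> 'a list set" where
  "linear_extensions X = {xs. distinct xs \<and> set xs = carr X \<and>
     (\<forall>i<length xs. \<forall>j<length xs. (xs ! i, xs ! j) \<in> le X \<longrightarrow> i \<le> j)}"

definition W :: "'a labelled_poset \<Rightarrow> ncpoly" where
  "W X = (\<Sum>xs\<in>linear_extensions X. wd (map (lab X) xs))"

text \<open>The pair \<open>(j, i)\<close>, with both components counted from 1, stands for $b_{j,i}$.\<close>

definition P_carr :: "nat list \<Rightarrow> (nat \<times> nat) set" where
  "P_carr l = {(j, i). 1 \<le> j \<and> j \<le> length l \<and> 1 \<le> i \<and> i \<le> l ! (j - 1)}"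

definition P_gen :: "nat list \<Rightarrow> ((nat \<times> nat) \<times> (nat \<times> nat)) set" where
  "P_gen l = {((j, i), (j, i + 1)) | j i. 1 \<le> j \<and> j \<le> length l \<and> 1 \<le> i \<and> i < l ! (j - 1)}
     \<union> {((j - 1, 1), (j, l ! (j - 1))) | j. 2 \<le> j \<and> j \<le> length l}"

definition P_lab :: "letter \<Rightarrow> nat list \<Rightarrow> nat \<times> nat \<Rightarrow> letter" where
  "P_lab \<delta> l = (\<lambda>(j, i). if 2 \<le> i then E0 else if j = length l then \<delta> else E1)"

definition P :: "letter \<Rightarrow> nat list \<Rightarrow> (nat \<times> nat) labelled_poset" where
  "P \<delta> l = \<lparr>carr = P_carr l, le = generated_order (P_carr l) (P_gen l), lab = P_lab \<delta> l\<rparr>"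

text \<open>\<open>Inl t\<close> stands for $a_t$ and \<open>Inr (j, i)\<close> for $b_{j,i}$.\<close>

definition Q_carr :: "nat list \<Rightarrow> nat list \<Rightarrow> (nat + nat \<times> nat) set" where
  "Q_carr k l = Inl ` {1..sum_list k} \<union> Inr ` P_carr l"

definition Q_gen :: "nat list \<Rightarrow> nat list \<Rightarrow> ((nat + nat \<times> nat) \<times> (nat + nat \<times> nat)) set" where
  "Q_gen k l = {(Inl t, Inl (t + 1)) | t. 1 \<le> t \<and> t < sum_list k}
     \<union> {(Inr x, Inr y) | x y. (x, y) \<in> P_gen l}
     \<union> {(Inl (sum_list k), Inr (length l, 1))}"

definition Q_lab :: "nat list \<Rightarrow> nat list \<Rightarrow> nat + nat \<times> nat \<Rightarrow> letter" where
  "Q_lab k l = case_sum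
     (\<lambda>t. if t \<in> {sum_list (take j k) + 1 | j. j < length k} then E1 else E0) (P_lab E0 l)"

definition Q :: "nat list \<Rightarrow> nat list \<Rightarrow> (nat + nat \<times> nat) labelled_poset" where
  "Q k l = \<lparr>carr = Q_carr k l, le = generated_order (Q_carr k l) (Q_gen k l), lab = Q_lab k l\<rparr>"

definition mu :: "nat list \<Rightarrow> nat list \<Rightarrow> ncpoly" where
  "mu k l = W (Q k l)"

text \<open>Maps on \<open>H0\<close> and \<open>H1\<close> are total functions constrained on these subspaces only.\<close>

definition Q_linear_on_H0 :: "(ncpoly \<Rightarrow> real) \<Rightarrow> bool" where
  "Q_linear_on_H0 Z \<longleftrightarrow> (\<forall>p\<in>H0. \<forall>q\<in>H0. Z (p + q) = Z p + Z q) \<and>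
     (\<forall>c. \<forall>p\<in>H0. Z (qsc c p) = of_rat c * Z p)"

definition double_shuffle :: "(ncpoly \<Rightarrow> real) \<Rightarrow> bool" where
  "double_shuffle Z \<longleftrightarrow> (\<forall>v\<in>H0. \<forall>w\<in>H0.
     Z (shuffle v w) = Z (harmonic v w) \<and> Z (harmonic v w) = Z v * Z w)"

text \<open>
  \<open>is_regularization m Z f\<close>: on \<open>H1\<close>, \<open>f\<close> is a (unital) algebra homomorphism to the real
  polynomials in $T$ for the product \<open>m\<close>; it extends \<open>Z\<close> and sends $e_1$ to $T$. Being a function
  on \<open>H1\<close>, it is normalised to 0 elsewhere.
\<close>

definition is_regularization ::
    "(ncpoly \<Rightarrow> ncpoly \<Rightarrow> ncpoly) \<Rightarrow> (ncpoly \<Rightarrow> real) \<Rightarrow> (ncpoly \<Rightarrow> real poly) \<Rightarrow> bool" where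
  "is_regularization m Z f \<longleftrightarrow>
     (\<forall>p\<in>H1. \<forall>q\<in>H1. f (p + q) = f p + f q) \<and>
     (\<forall>c. \<forall>p\<in>H1. f (qsc c p) = smult (of_rat c) (f p)) \<and>
     f 1 = 1 \<and>
     (\<forall>p\<in>H1. \<forall>q\<in>H1. f (m p q) = f p * f q) \<and>
     (\<forall>p\<in>H0. f p = [:Z p:]) \<and>
     f (ee 1) = [:0, 1:] \<and>
     (\<forall>p. p \<notin> H1 \<longrightarrow> f p = 0)"

text \<open>
  A \<open>Z\<close> that satisfies the double shuffle relation has \<open>Z 1 \<in> {0, 1}\<close>. If \<open>Z 1 = 0\<close> then \<open>Z\<close>
  vanishes on \<open>H0\<close> and no unital homomorphism extends it; only for this degenerate \<open>Z\<close> is the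
  default value 0 used.
\<close>

definition regularization ::
    "(ncpoly \<Rightarrow> ncpoly \<Rightarrow> ncpoly) \<Rightarrow> (ncpoly \<Rightarrow> real) \<Rightarrow> ncpoly \<Rightarrow> real poly" where
  "regularization m Z =
     (if \<exists>f. is_regularization m Z f then (THE f. is_regularization m Z f) else (\<lambda>_. 0))"

definition Z_sh :: "(ncpoly \<Rightarrow> real) \<Rightarrow> ncpoly \<Rightarrow> real poly" where
  "Z_sh Z = regularization shuffle Z"

definition Z_har :: "(ncpoly \<Rightarrow> real) \<Rightarrow> ncpoly \<Rightarrow> real poly" where
  "Z_har Z = regularization harmonic Z"

definition Z_sh_star :: "(ncpoly \<Rightarrow> real) \<Rightarrow> nat list \<Rightarrow> real poly" where
  "Z_sh_star Z k = Z_sh Z (W (P E1 k))"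

definition Z_har_star :: "(ncpoly \<Rightarrow> real) \<Rightarrow> nat list \<Rightarrow> real poly" where
  "Z_har_star Z k = Z_har Z (star k)"

definition A_series :: "(ncpoly \<Rightarrow> real) \<Rightarrow> real fps" where
  "A_series Z = fps_exp 1 oo Abs_fps (\<lambda>n. if 2 \<le> n then (-1) ^ n / of_nat n * Z (ee n) else 0)"

text \<open>$e^{Tu}$ as a power series in $u$ over the polynomials in $T$.\<close>

definition exp_Tu :: "real poly fps" where
  "exp_Tu = Abs_fps (\<lambda>n. monom (1 / fact n) n)"

definition is_rho :: "real fps \<Rightarrow> (real poly \<Rightarrow> real poly) \<Rightarrow> bool" where
  "is_rho A r \<longleftrightarrow> (\<forall>p q. r (p + q) = r p + r q) \<and> (\<forall>c p. r (smult c p) = smult c (r p)) \<and>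
     Abs_fps (\<lambda>n. r (fps_nth exp_Tu n)) = Abs_fps (\<lambda>n. [:fps_nth A n:]) * exp_Tu"

definition rho_of :: "real fps \<Rightarrow> real poly \<Rightarrow> real poly" where
  "rho_of A = (THE r. is_rho A r)"

definition rho :: "(ncpoly \<Rightarrow> real) \<Rightarrow> real poly \<Rightarrow> real poly" where
  "rho Z = rho_of (A_series Z)"

definition rho_star :: "(ncpoly \<Rightarrow> real) \<Rightarrow> real poly \<Rightarrow> real poly" where
  "rho_star Z = rho_of (inverse (A_series Z oo (- fps_X)))"

definition Reg :: "(ncpoly \<Rightarrow> real) \<Rightarrow> bool" where
  "Reg Z \<longleftrightarrow> (\<forall>k. is_index k \<longrightarrow> Z_sh Z (ind k) = rho Z (Z_har Z (ind k)))"

definition Reg_star :: "(ncpoly \<Rightarrow> real) \<Rightarrow> bool" where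
  "Reg_star Z \<longleftrightarrow> (\<forall>k. is_index k \<longrightarrow> Z_sh_star Z k = rho_star Z (Z_har_star Z k))"

definition Int_Ser :: "(ncpoly \<Rightarrow> real) \<Rightarrow> bool" where
  "Int_Ser Z \<longleftrightarrow> (\<forall>k l. is_index k \<and> is_index l \<and> k \<noteq> [] \<and> l \<noteq> [] \<longrightarrow>
     Z (mu k l) = Z (circledast (ind k) (star l)))"



lemma wd_mult: "wd v * wd w = wd (v @ w)"
  by (simp add: wd_def mult_single plus_list_def)

lemma wd_Nil: "wd [] = 1"
  unfolding wd_def by (metis single_one zero_list_def)

lemma wd_power: "wd [a] ^ n = wd (replicate n a)"
  by (induction n) (simp_all add: wd_Nil wd_mult)

definition index_word :: "nat list \<Rightarrow> letter list" where
  "index_word k = concat (map (\<lambda>n. E1 # replicate (n - 1) E0) k)"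

lemma ind_eq_wd: "ind k = wd (index_word k)"
  by (induction k) (simp_all add: ind_def index_word_def ee_def wd_Nil wd_mult wd_power)

lemma index_of_index_word: "is_index k \<Longrightarrow> index_of (index_word k) = k"
proof (induction k)
  case Nil
  then show ?case by (simp add: index_word_def)
next
  case (Cons n k)
  have hd: "index_word k = [] \<or> (\<exists>w. index_word k = E1 # w)"
    by (cases k) (auto simp: index_word_def)
  have "takeWhile ((=) E0) (replicate (n - 1) E0 @ index_word k) = replicate (n - 1) E0"
    "dropWhile ((=) E0) (replicate (n - 1) E0 @ index_word k) = index_word k"
    using hd by (auto simp: takeWhile_append dropWhile_append)
  moreover have "index_word (n # k) = E1 # replicate (n - 1) E0 @ index_word k"
    by (simp add: index_word_def)
  ultimately show ?case
    using Cons by (simp add: is_index_def)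
qed

lemma index_of_ind: "is_index k \<Longrightarrow> ind k = wd w \<Longrightarrow> index_of w = k"
proof -
  assume k: "is_index k" and "ind k = wd w"
  then have "Poly_Mapping.keys (wd (index_word k)) = Poly_Mapping.keys (wd w)"
    by (simp add: ind_eq_wd)
  then have "index_word k = w" by (simp add: wd_def)
  then show "index_of w = k" using index_of_index_word[OF k] by simp
qed

lemma ind_index_of:
  assumes "w = [] \<or> hd w = E1"
  shows "is_index (index_of w) \<and> ind (index_of w) = wd w"
proof -
  have "is_index (index_of w) \<and> index_word (index_of w) = w"
    using assms
  proof (induction w rule: index_of.induct)
    case 1
    then show ?case by (simp add: is_index_def index_word_def)
  next
    case (2 a w)
    let ?t = "takeWhile ((=) E0) w" and ?d = "dropWhile ((=) E0) w"
    have "?d = [] \<or> hd ?d = E1"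
      using hd_dropWhile[of "(=) E0" w] by (cases "hd ?d") auto
    then have IH: "is_index (index_of ?d)" "index_word (index_of ?d) = ?d"
      using 2(1) by blast+
    have "?t = replicate (length ?t) E0"
      by (rule replicate_eqI) (auto dest: set_takeWhileD)
    then have "replicate (length ?t) E0 @ ?d = w"
      by (metis takeWhile_dropWhile_id)
    moreover have "index_word (index_of (a # w)) = E1 # replicate (length ?t) E0 @ ?d"
      using IH(2) by (simp add: index_word_def)
    ultimately show ?case
      using IH(1) 2(2) by (simp add: is_index_def)
  qed
  then show ?thesis by (simp add: ind_eq_wd)
qed

lemma two_poset_generated:
  assumes "finite (carr X)" and "le X = generated_order (carr X) r"
    and "r \<subseteq> carr X \<times> carr X" and "acyclic r"
  shows "two_poset X"
proof -
  have "r\<^sup>+ \<subseteq> carr X \<times> carr X"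
    using assms(3) by (rule trancl_subset_Sigma)
  moreover have "trans (Id_on (carr X) \<union> r\<^sup>+)"
    by (rule transI) (auto intro: trancl_trans)
  moreover have "antisym (Id_on (carr X) \<union> r\<^sup>+)"
    using assms(4) by (auto simp: antisym_def acyclic_def dest: trancl_trans)
  ultimately show ?thesis
    using assms(1,2)
    by (auto simp: two_poset_def generated_order_def partial_order_on_def preorder_on_def refl_on_def)
qed

lemma finite_P_carr: "finite (P_carr l)"
proof (rule finite_subset)
  show "P_carr l \<subseteq> (SIGMA j:{1..length l}. {1..l ! (j - 1)})"
    by (auto simp: P_carr_def)
qed auto

lemma P_gen_carr:
  assumes "is_index l"
  shows "P_gen l \<subseteq> P_carr l \<times> P_carr l"
proof -
  have "1 \<le> l ! j" if "j < length l" for j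
    using assms that by (simp add: is_index_def)
  then show ?thesis
    by (force simp: P_gen_def P_carr_def)
qed

lemma P_gen_lex: "P_gen l \<subseteq> less_than <*lex*> less_than"
  by (auto simp: P_gen_def)

lemma two_poset_P:
  assumes "is_index l"
  shows "two_poset (P \<delta> l)"
proof (rule two_poset_generated)
  show "acyclic (P_gen l)"
    by (rule wf_acyclic, rule wf_subset[OF _ P_gen_lex]) auto
qed (use assms finite_P_carr P_gen_carr in \<open>auto simp: P_def\<close>)

lemma two_poset_Q:
  assumes "is_index k" "is_index l" "k \<noteq> []" "l \<noteq> []"
  shows "two_poset (Q k l)"
proof (rule two_poset_generated)
  let ?m = "case_sum (\<lambda>t. (0::nat, t, 0::nat)) (\<lambda>x. (1, x))"
  have "Q_gen k l \<subseteq> inv_image (less_than <*lex*> less_than <*lex*> less_than) ?m"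
    using P_gen_lex[of l] by (auto simp: Q_gen_def)
  then show "acyclic (Q_gen k l)"
    by (intro wf_acyclic) (rule wf_subset[rotated], auto)
  have "1 \<le> sum_list k"
    using assms(1,3) by (cases k) (auto simp: is_index_def)
  moreover have "(length l, 1) \<in> P_carr l"
    using assms(2,4) by (simp add: P_carr_def is_index_def Suc_le_eq)
  ultimately show "Q_gen k l \<subseteq> carr (Q k l) \<times> carr (Q k l)"
    using P_gen_carr[OF assms(2)] by (auto simp: Q_gen_def Q_def Q_carr_def)
  show "finite (carr (Q k l))"
    by (simp add: Q_def Q_carr_def finite_P_carr)
qed (simp add: Q_def)

lemma ex1_is_rho: "\<exists>!r. is_rho A r"
proof -
  define B where "B = Abs_fps (\<lambda>n. [:fps_nth A n:]) * exp_Tu"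
  define r where "r p = (\<Sum>n\<le>degree p. smult (coeff p n * fact n) (fps_nth B n))" for p :: "real poly"
  have r_eq: "r p = (\<Sum>n\<le>N. smult (coeff p n * fact n) (fps_nth B n))" if "degree p \<le> N" for p N
    unfolding r_def using that by (intro sum.mono_neutral_left) (auto simp: coeff_eq_0)
  have "is_rho A r"
    unfolding is_rho_def B_def[symmetric]
  proof (intro conjI allI)
    show "r (p + q) = r p + r q" for p q
      by (simp add: r_eq[of _ "max (degree p) (degree q)"] degree_add_le sum.distrib
          smult_add_left algebra_simps)
    show "r (smult c p) = smult c (r p)" for c p
    proof -
      have "r (smult c p) = (\<Sum>n\<le>degree p. smult c (smult (coeff p n * fact n) (fps_nth B n)))"
        by (simp add: r_eq[of _ "degree p"] mult.assoc)
      also have "\<dots> = smult c (r p)"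
        unfolding r_def using sum_distrib_left[of "[:c:]" _ "{..degree p}"] by simp
      finally show ?thesis .
    qed
    show "Abs_fps (\<lambda>n. r (fps_nth exp_Tu n)) = B"
    proof (rule fps_ext)
      fix n
      have "r (fps_nth exp_Tu n) =
          (\<Sum>i\<le>n. smult (coeff (monom (1 / fact n) n) i * fact i) (fps_nth B i))"
        by (simp add: exp_Tu_def r_eq[of _ n] degree_monom_le)
      also have "\<dots> = (\<Sum>i\<le>n. if i = n then fps_nth B n else 0)"
        by (rule sum.cong) auto
      finally show "fps_nth (Abs_fps (\<lambda>n. r (fps_nth exp_Tu n))) n = fps_nth B n"
        by simp
    qed
  qed
  moreover have "s = r" if "is_rho A s" for s
  proof
    fix p
    have mon: "s (monom (1 / fact n) n) = r (monom (1 / fact n) n)" for n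
    proof -
      have "Abs_fps (\<lambda>n. s (fps_nth exp_Tu n)) = Abs_fps (\<lambda>n. r (fps_nth exp_Tu n))"
        using that \<open>is_rho A r\<close> by (simp add: is_rho_def)
      then have "fps_nth (Abs_fps (\<lambda>n. s (fps_nth exp_Tu n))) n =
          fps_nth (Abs_fps (\<lambda>n. r (fps_nth exp_Tu n))) n" by simp
      then show ?thesis by (simp add: exp_Tu_def)
    qed
    have lin: "t p = (\<Sum>n\<le>degree p. smult (coeff p n * fact n) (t (monom (1 / fact n) n)))"
      if "is_rho A t" for t
    proof -
      have add: "t (x + y) = t x + t y" and sc: "t (smult c x) = smult c (t x)" for x y c
        using that by (auto simp: is_rho_def)
      have t0: "t 0 = 0" using sc[of 0 0] by simp
      have "t (\<Sum>n\<in>I. f n) = (\<Sum>n\<in>I. t (f n))" if "finite I" for I and f :: "nat \<Rightarrow> real poly"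
        using that by (induction I rule: finite_induct) (auto simp: add t0)
      then have "t (\<Sum>n\<le>degree p. smult (coeff p n * fact n) (monom (1 / fact n) n)) =
          (\<Sum>n\<le>degree p. smult (coeff p n * fact n) (t (monom (1 / fact n) n)))"
        by (simp add: sc del: smult_monom)
      moreover have "(\<Sum>n\<le>degree p. smult (coeff p n * fact n) (monom (1 / fact n) n)) = p"
        by (simp add: smult_monom poly_as_sum_of_monoms)
      ultimately show ?thesis by simp
    qed
    show "s p = r p"
      using lin[OF that] lin[OF \<open>is_rho A r\<close>] by (simp add: mon)
  qed
  ultimately show ?thesis by blast
qed

lemma is_rho_rho_of: "is_rho A (rho_of A)"
  unfolding rho_of_def by (rule theI'[OF ex1_is_rho])

end

theory Submission
  imports Defs
begin

text \<open>
  Removing a trailing $e_1$ is a derivation for both products, with kernel \<open>H0\<close> on \<open>H1\<close> and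
  with value 1 on $e_1$. Hence \<open>H1\<close> is a polynomial algebra over \<open>H0\<close>, the regularizations
  exist, and they turn this derivation into $D = d/dT$, while $\rho_Z = A_Z(D)$ and
  $\rho^\star_Z = A_Z(-D)^{-1}$.

  Splitting on the relative position of $n_s$ and $m_r$ in the series, respectively of $b_{s,1}$
  and $a_K$ in the poset, gives the same recursion for $\mathbf{k} \circledast \mathbf{l}^\star$
  and for $\mu(\mathbf{k},\mathbf{l})$: both are the alternating sums
  $\sum_j (-1)^{s-j} (\mathbf{k},l_s,\dots,l_{j+1}) \cdot (l_1,\dots,l_j)^\star$ for the respective
  product, and these sums vanish if $\mathbf{k}$ is empty and $\mathbf{l}$ is not. If $D$ kills the
  regularized value of $\mathbf{k}$, integration by parts shows that such a sum does not change when
  $A(D)$ is applied to the first and $A(-D)^{-1}$ to the second factors. This gives (Reg)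
  $\Leftrightarrow$ (Reg$^\star$), and (Reg) $\Rightarrow$ (Int-Ser). For the converse it suffices to
  take $\mathbf{l} = (1,\dots,1)$, because (Reg) always holds for $(1,\dots,1)$ by Newton's identity.
\<close>

section \<open>Linear maps on words\<close>

text \<open>Why only admissible indices enter (Int-Ser): on both sides the last entries c of k and d
  of l occur only through c + d >= 2. So (Int-Ser) compares the two alternating sums for indices
  whose last entry is at least 2, and for these \<open>D\<close> kills the regularized value, which
  is the condition for integration by parts without boundary term. Why integration by parts works:
  \<open>D\<close> shortens an index from its end and a star value, stored with reversed index, from
  its front, in both cases by an entry 1. Both effects take place at the cut between the two
  factors, so neighbouring terms of the alternating sum cancel. Moving \<open>D\<close> across costs
  a sign, which is the origin of the series A(-u)^(-1) on the star side: the two operators combine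
  to A(-u) A(-u)^(-1) = 1. Why ones suffice for the converse: the longest nonstar value in the sum
  for k and l occurs in one term only, with star factor 1. An index is empty or ends in an entry >=
  2, up to trailing ones. Taking these ones for l leaves star values of ones and nonstar values with
  fewer trailing ones, so induction on their number applies.\<close>

lemma lookup_qsc [simp]: "Poly_Mapping.lookup (qsc c p) w = c * Poly_Mapping.lookup p w"
proof -
  have "qsc c p = Poly_Mapping.map ((*) c) p"
    by (simp add: qsc_def mult_map_scale_conv_mult zero_list_def)
  then show ?thesis by (simp add: Poly_Mapping.map.rep_eq when_def)
qed

lemma ncpoly_eqI: "(\<And>w. Poly_Mapping.lookup p w = Poly_Mapping.lookup q w) \<Longrightarrow> p = (q::ncpoly)"
  by (rule poly_mapping_eqI)

lemma qsc_add: "qsc c (p + q) = qsc c p + qsc c q"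
  by (rule ncpoly_eqI) (simp add: lookup_add algebra_simps)

lemma qsc_add_left: "qsc (c + d) p = qsc c p + qsc d p"
  by (rule ncpoly_eqI) (simp add: lookup_add algebra_simps)

lemma qsc_0 [simp]: "qsc c 0 = 0" "qsc 0 p = 0" and qsc_1 [simp]: "qsc 1 p = p"
  by (rule ncpoly_eqI, simp)+

lemma qsc_qsc [simp]: "qsc c (qsc d p) = qsc (c * d) p"
  by (rule ncpoly_eqI) (simp add: mult.assoc)

lemma mult_qsc_left [simp]: "qsc c p * q = qsc c (p * q)"
  by (simp add: qsc_def mult.assoc)

lemma uminus_eq_qsc: "- p = qsc (-1) p"
  by (rule ncpoly_eqI) simp

text \<open>The word case is restricted to the support of \<open>p\<close>, so that conditions on
  the support, such as membership in \<open>H1\<close> or \<open>H0\<close>, remain available inside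
  an induction.\<close>

lemma ncpoly_induct [case_names zero word add qsc]:
  assumes "R 0" "\<And>w. w \<in> Poly_Mapping.keys p \<Longrightarrow> R (wd w)"
    and "\<And>p q. R p \<Longrightarrow> R q \<Longrightarrow> R (p + q)" "\<And>c p. R p \<Longrightarrow> R (qsc c p)"
  shows "R (p::ncpoly)"
proof -
  have "R (\<Sum>w\<in>A. qsc (Poly_Mapping.lookup p w) (wd w))" if "finite A" "A \<subseteq> Poly_Mapping.keys p" for A
    using that by (induction A rule: finite_induct) (auto intro: assms)
  moreover have "(\<Sum>w\<in>Poly_Mapping.keys p. qsc (Poly_Mapping.lookup p w) (wd w)) = p"
    by (rule ncpoly_eqI)
      (auto simp: lookup_sum wd_def lookup_single when_def if_distrib sum.delta in_keys_iff cong: if_cong)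
  ultimately show ?thesis by (metis finite_keys order_refl)
qed

lemma mult_qsc_right [simp]: "p * qsc c q = qsc c (p * q)"
proof (induction p rule: ncpoly_induct)
  case (word w)
  have "wd w * Poly_Mapping.single [] c = Poly_Mapping.single [] c * wd w"
    by (simp add: wd_def mult_single plus_list_def)
  then show ?case by (simp add: qsc_def flip: mult.assoc)
qed (simp_all add: distrib_right qsc_add mult.commute[of c])

text \<open>Two nested copies make up \<open>bilin\<close>, whose linearity in each argument is
  thereby inherited.\<close>

definition lext :: "(letter list \<Rightarrow> ncpoly) \<Rightarrow> ncpoly \<Rightarrow> ncpoly" where
  "lext g p = (\<Sum>w\<in>Poly_Mapping.keys p. qsc (Poly_Mapping.lookup p w) (g w))"

lemma lext_superset:
  "finite A \<Longrightarrow> Poly_Mapping.keys p \<subseteq> A \<Longrightarrow> lext g p = (\<Sum>w\<in>A. qsc (Poly_Mapping.lookup p w) (g w))"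
  unfolding lext_def by (rule sum.mono_neutral_left) (auto simp: in_keys_iff)

lemma lext_add: "lext g (p + q) = lext g p + lext g q"
proof -
  let ?A = "Poly_Mapping.keys p \<union> Poly_Mapping.keys q"
  have "lext g (p + q) = (\<Sum>w\<in>?A. qsc (Poly_Mapping.lookup (p + q) w) (g w))"
    by (rule lext_superset) (simp_all add: keys_add)
  also have "\<dots> = (\<Sum>w\<in>?A. qsc (Poly_Mapping.lookup p w) (g w)) +
      (\<Sum>w\<in>?A. qsc (Poly_Mapping.lookup q w) (g w))"
    by (simp add: lookup_add qsc_add_left sum.distrib)
  also have "\<dots> = lext g p + lext g q"
    using lext_superset[of ?A p g] lext_superset[of ?A q g] by simp
  finally show ?thesis .
qed

lemma qsc_sum: "qsc c (sum g A) = (\<Sum>w\<in>A. qsc c (g w))"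
  by (induction A rule: infinite_finite_induct) (simp_all add: qsc_add)

lemma lext_qsc: "lext g (qsc c p) = qsc c (lext g p)"
proof -
  have "lext g (qsc c p) = (\<Sum>w\<in>Poly_Mapping.keys p. qsc (Poly_Mapping.lookup (qsc c p) w) (g w))"
    by (rule lext_superset) (auto simp: in_keys_iff)
  then show ?thesis by (simp add: lext_def qsc_sum)
qed

lemma lext_0 [simp]: "lext g 0 = 0"
  by (simp add: lext_def)

lemma lext_wd [simp]: "lext g (wd w) = g w"
  by (simp add: lext_def wd_def)

lemma lext_fun_add: "lext (\<lambda>v. g v + h v) p = lext g p + lext h p"
  by (simp add: lext_def qsc_add sum.distrib)

lemma lext_fun_qsc: "lext (\<lambda>v. qsc c (g v)) p = qsc c (lext g p)"
  by (simp add: lext_def qsc_sum mult.commute)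

lemma bilin_lext: "bilin f p q = lext (\<lambda>v. lext (f v) q) p"
  by (simp add: bilin_def lext_def qsc_sum)

lemma bilin_add_left: "bilin f (p + q) r = bilin f p r + bilin f q r"
  and bilin_add_right: "bilin f p (q + r) = bilin f p q + bilin f p r"
  and bilin_qsc_left: "bilin f (qsc c p) q = qsc c (bilin f p q)"
  and bilin_qsc_right: "bilin f p (qsc c q) = qsc c (bilin f p q)"
  and bilin_0_left: "bilin f 0 p = 0"
  and bilin_0_right: "bilin f p 0 = 0"
  and bilin_wd: "bilin f (wd v) (wd w) = f v w"
  by (simp_all add: bilin_lext lext_add lext_qsc lext_fun_add lext_fun_qsc)
    (simp_all add: lext_def)

lemmas shuffle_lin [simp] = bilin_add_left[of shuffle_word, folded shuffle_def]
  bilin_add_right[of shuffle_word, folded shuffle_def]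
  bilin_qsc_left[of shuffle_word, folded shuffle_def]
  bilin_qsc_right[of shuffle_word, folded shuffle_def]
  bilin_0_left[of shuffle_word, folded shuffle_def]
  bilin_0_right[of shuffle_word, folded shuffle_def]

lemma shuffle_wd: "shuffle (wd v) (wd w) = shuffle_word v w"
  by (simp add: shuffle_def bilin_wd)

lemma harmonic_lin [simp]:
  "harmonic (p + q) r = harmonic p r + harmonic q r"
  "harmonic p (q + r) = harmonic p q + harmonic p r"
  "harmonic (qsc c p) q = qsc c (harmonic p q)"
  "harmonic p (qsc c q) = qsc c (harmonic p q)"
  "harmonic 0 p = 0" "harmonic p 0 = 0"
  by (simp_all add: harmonic_def bilin_add_left bilin_add_right bilin_qsc_left bilin_qsc_right
      bilin_0_left bilin_0_right)

lemma harmonic_ind_ind: "is_index k \<Longrightarrow> is_index l \<Longrightarrow> harmonic (ind k) (ind l) = harmonic_ind k l"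
  by (simp add: harmonic_def bilin_wd ind_eq_wd index_of_index_word)

lemma wd_in_keys_mult:
  "w \<in> Poly_Mapping.keys (p * q) \<Longrightarrow>
   \<exists>u\<in>Poly_Mapping.keys p. \<exists>v\<in>Poly_Mapping.keys (q::ncpoly). w = u @ v"
  using keys_mult[of p q] by (fastforce simp: plus_list_def)

lemma keys_wd [simp]: "Poly_Mapping.keys (wd w) = {w}"
  by (simp add: wd_def)

lemma lookup_wd: "Poly_Mapping.lookup (wd w) u = (if u = w then 1 else 0)"
  by (auto simp: wd_def lookup_single when_def)

section \<open>Membership in \<open>H1\<close> and \<open>H0\<close> read off from the
  support\<close>

lemma H1_iff: "p \<in> H1 \<longleftrightarrow> (\<forall>w\<in>Poly_Mapping.keys p. w = [] \<or> hd w = E1)"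
proof
  assume "p \<in> H1"
  then obtain c h where p: "p = qsc c 1 + wd [E1] * h" by (auto simp: H1_def)
  show "\<forall>w\<in>Poly_Mapping.keys p. w = [] \<or> hd w = E1"
  proof
    fix w assume "w \<in> Poly_Mapping.keys p"
    then have "w = [] \<or> w \<in> Poly_Mapping.keys (wd [E1] * h)"
      unfolding p by (auto simp: in_keys_iff lookup_add lookup_one when_def zero_list_def)
    then show "w = [] \<or> hd w = E1"
      by (auto dest!: wd_in_keys_mult)
  qed
next
  assume *: "\<forall>w\<in>Poly_Mapping.keys p. w = [] \<or> hd w = E1"
  show "p \<in> H1"
  proof (induction p rule: ncpoly_induct)
    case zero
    have "0 = qsc 0 1 + wd [E1] * 0" by simp
    then show ?case unfolding H1_def by blast
  next
    case (word w)
    have "wd w = qsc 0 1 + wd [E1] * wd (tl w)" if "w \<noteq> []" "hd w = E1"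
      using that by (cases w) (auto simp: wd_mult)
    moreover have "wd [] = qsc 1 1 + wd [E1] * 0" by (simp add: wd_Nil)
    ultimately have "\<exists>c h. wd w = qsc c 1 + wd [E1] * h" using *[rule_format, OF word] by metis
    then show ?case unfolding H1_def by blast
  next
    case (add p q)
    then obtain c h d h' where "p = qsc c 1 + wd [E1] * h" "q = qsc d 1 + wd [E1] * h'"
      by (auto simp: H1_def)
    then have "p + q = qsc (c + d) 1 + wd [E1] * (h + h')"
      by (simp add: qsc_add_left distrib_left)
    then show ?case unfolding H1_def by blast
  next
    case (qsc c p)
    then obtain d h where "p = qsc d 1 + wd [E1] * h" by (auto simp: H1_def)
    then have "qsc c p = qsc (c * d) 1 + wd [E1] * qsc c h" by (simp add: qsc_add)
    then show ?case unfolding H1_def by blast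
  qed
qed

lemma H0_iff: "p \<in> H0 \<longleftrightarrow> (\<forall>w\<in>Poly_Mapping.keys p. w = [] \<or> hd w = E1 \<and> last w = E0)"
proof
  assume "p \<in> H0"
  then obtain c h where p: "p = qsc c 1 + wd [E1] * h * wd [E0]" by (auto simp: H0_def)
  show "\<forall>w\<in>Poly_Mapping.keys p. w = [] \<or> hd w = E1 \<and> last w = E0"
  proof
    fix w assume "w \<in> Poly_Mapping.keys p"
    then have "w = [] \<or> w \<in> Poly_Mapping.keys (wd [E1] * h * wd [E0])"
      unfolding p by (auto simp: in_keys_iff lookup_add lookup_one when_def zero_list_def)
    then show "w = [] \<or> hd w = E1 \<and> last w = E0"
      by (auto dest!: wd_in_keys_mult)
  qed
next
  assume *: "\<forall>w\<in>Poly_Mapping.keys p. w = [] \<or> hd w = E1 \<and> last w = E0"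
  show "p \<in> H0"
  proof (induction p rule: ncpoly_induct)
    case zero
    have "0 = qsc 0 1 + wd [E1] * 0 * wd [E0]" by simp
    then show ?case unfolding H0_def by blast
  next
    case (word w)
    have "wd w = qsc 0 1 + wd [E1] * wd (tl (butlast w)) * wd [E0]"
      if "w \<noteq> []" "hd w = E1" "last w = E0"
    proof -
      have "w = [E1] @ tl (butlast w) @ [E0]"
        using that by (cases w; cases "tl w" rule: rev_cases) auto
      then show ?thesis by (simp add: wd_mult)
    qed
    moreover have "wd [] = qsc 1 1 + wd [E1] * 0 * wd [E0]" by (simp add: wd_Nil)
    ultimately have "\<exists>c h. wd w = qsc c 1 + wd [E1] * h * wd [E0]" using *[rule_format, OF word] by metis
    then show ?case unfolding H0_def by blast
  next
    case (add p q)
    then obtain c h d h' where "p = qsc c 1 + wd [E1] * h * wd [E0]"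
        "q = qsc d 1 + wd [E1] * h' * wd [E0]"
      by (auto simp: H0_def)
    then have "p + q = qsc (c + d) 1 + wd [E1] * (h + h') * wd [E0]"
      by (simp add: qsc_add_left distrib_left distrib_right)
    then show ?case unfolding H0_def by blast
  next
    case (qsc c p)
    then obtain d h where "p = qsc d 1 + wd [E1] * h * wd [E0]" by (auto simp: H0_def)
    then have "qsc c p = qsc (c * d) 1 + wd [E1] * qsc c h * wd [E0]" by (simp add: qsc_add)
    then show ?case unfolding H0_def by blast
  qed
qed

lemma H1_iff_lookup: "p \<in> H1 \<longleftrightarrow> (\<forall>w. w \<noteq> [] \<and> hd w \<noteq> E1 \<longrightarrow> Poly_Mapping.lookup p w = 0)"
  unfolding H1_iff by (auto simp: in_keys_iff)

lemma H0_iff_lookup: "p \<in> H0 \<longleftrightarrow>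
    (\<forall>w. w \<noteq> [] \<and> (hd w \<noteq> E1 \<or> last w \<noteq> E0) \<longrightarrow> Poly_Mapping.lookup p w = 0)"
  unfolding H0_iff by (auto simp: in_keys_iff)

lemma H0_subset_H1: "p \<in> H0 \<Longrightarrow> p \<in> H1"
  by (auto simp: H0_iff H1_iff)

lemma H1_closed [simp, intro]:
  "0 \<in> H1" "1 \<in> H1" "p \<in> H1 \<Longrightarrow> q \<in> H1 \<Longrightarrow> p + q \<in> H1" "p \<in> H1 \<Longrightarrow> q \<in> H1 \<Longrightarrow> p - q \<in> H1"
  "p \<in> H1 \<Longrightarrow> qsc c p \<in> H1" "p \<in> H1 \<Longrightarrow> - p \<in> H1" "ind k \<in> H1"
proof -
  have "index_word k = [] \<or> hd (index_word k) = E1"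
    by (cases k) (auto simp: index_word_def)
  then show "ind k \<in> H1" by (simp add: ind_eq_wd H1_iff)
  show "1 \<in> H1" by (simp add: H1_iff flip: wd_Nil)
qed (auto simp: H1_iff_lookup lookup_add lookup_minus)

lemma H0_closed [simp, intro]:
  "0 \<in> H0" "1 \<in> H0" "p \<in> H0 \<Longrightarrow> q \<in> H0 \<Longrightarrow> p + q \<in> H0" "p \<in> H0 \<Longrightarrow> q \<in> H0 \<Longrightarrow> p - q \<in> H0"
  "p \<in> H0 \<Longrightarrow> qsc c p \<in> H0" "p \<in> H0 \<Longrightarrow> - p \<in> H0"
proof -
  show "1 \<in> H0" by (simp add: H0_iff flip: wd_Nil)
qed (auto simp: H0_iff_lookup lookup_add lookup_minus)

lemma H1_induct [consumes 1, case_names zero ind add qsc]: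
  assumes "p \<in> H1" "R 0" "\<And>k. is_index k \<Longrightarrow> R (ind k)"
    and "\<And>p q. p \<in> H1 \<Longrightarrow> q \<in> H1 \<Longrightarrow> R p \<Longrightarrow> R q \<Longrightarrow> R (p + q)"
    and "\<And>c p. p \<in> H1 \<Longrightarrow> R p \<Longrightarrow> R (qsc c p)"
  shows "R p"
proof -
  have "p \<in> H1 \<and> R p"
  proof (induction p rule: ncpoly_induct)
    case (word w)
    then have "w = [] \<or> hd w = E1" using assms(1) by (auto simp: H1_iff)
    then have "is_index (index_of w)" "ind (index_of w) = wd w" using ind_index_of by auto
    then show ?case using assms(3) H1_closed(7) by metis
  qed (use assms in auto)
  then show ?thesis by simp
qed

section \<open>The derivation that removes a trailing \<open>E1\<close>\<close>

definition dl :: "ncpoly \<Rightarrow> ncpoly" where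
  "dl = lext (\<lambda>w. if w \<noteq> [] \<and> last w = E1 then wd (butlast w) else 0)"

lemma dl_lin [simp]: "dl 0 = 0" "dl (p + q) = dl p + dl q" "dl (qsc c p) = qsc c (dl p)"
    "dl (- p) = - dl p" "dl (p - q) = dl p - dl q"
proof -
  show a: "dl (p + q) = dl p + dl q" for p q by (simp add: dl_def lext_add)
  show "dl (qsc c p) = qsc c (dl p)" for c p by (simp add: dl_def lext_qsc)
  then show "dl (- p) = - dl p" for p by (simp add: uminus_eq_qsc)
  then show "dl (p - q) = dl p - dl q" using a[of p "- q"] by simp
qed (simp add: dl_def)

lemma dl_mult_letter [simp]: "dl (p * wd [E1]) = p" "dl (p * wd [E0]) = 0"
proof -
  show "dl (p * wd [E1]) = p"
    by (induction p rule: ncpoly_induct) (simp_all add: wd_mult distrib_right, simp add: dl_def)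
  show "dl (p * wd [E0]) = 0"
    by (induction p rule: ncpoly_induct) (simp_all add: wd_mult distrib_right, simp add: dl_def)
qed

lemma dl_one [simp]: "dl 1 = 0"
  by (simp add: dl_def flip: wd_Nil)

lemma lookup_dl: "Poly_Mapping.lookup (dl p) u = Poly_Mapping.lookup p (u @ [E1])"
proof (induction p rule: ncpoly_induct)
  case (word w)
  show ?case
    by (cases w rule: rev_cases) (auto simp: dl_def lookup_wd)
qed (simp_all add: lookup_add)

lemma dl_H1 [simp]: "p \<in> H1 \<Longrightarrow> dl p \<in> H1"
  by (auto simp: H1_iff_lookup lookup_dl)

text \<open>This turns admissibility into an equation, so that closure of \<open>H0\<close> under
  either product follows from the Leibniz rule and closure of \<open>H1\<close>.\<close>

lemma H0_iff_dl: "p \<in> H0 \<longleftrightarrow> p \<in> H1 \<and> dl p = 0"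
proof
  assume "p \<in> H0"
  then have "dl p = 0"
    by (intro ncpoly_eqI) (simp add: H0_iff_lookup lookup_dl)
  with \<open>p \<in> H0\<close> show "p \<in> H1 \<and> dl p = 0" by (simp add: H0_subset_H1)
next
  assume p: "p \<in> H1 \<and> dl p = 0"
  show "p \<in> H0"
    unfolding H0_iff
  proof
    fix w assume w: "w \<in> Poly_Mapping.keys p"
    have "last w \<noteq> E1" if "w \<noteq> []"
    proof
      assume "last w = E1"
      then have "Poly_Mapping.lookup (dl p) (butlast w) \<noteq> 0"
        using w that by (metis append_butlast_last_id in_keys_iff lookup_dl)
      then show False using p by simp
    qed
    then show "w = [] \<or> hd w = E1 \<and> last w = E0"
      using p w by (metis H1_iff letter.exhaust)
  qed
qed

text \<open>Each application shortens words, so nothing is left once \<open>n\<close> exceeds the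
  longest word of the support. This makes the Taylor expansion in \<open>F\<close> finite and
  supplies the order on which later inductions run.\<close>

lemma dl_nilpotent: "\<exists>n. (dl ^^ n) p = 0"
proof -
  have lk: "Poly_Mapping.lookup ((dl ^^ n) p) u = Poly_Mapping.lookup p (u @ replicate n E1)" for n u
    by (induction n arbitrary: u) (simp_all add: lookup_dl replicate_app_Cons_same)
  define n where "n = Suc (Max (length ` Poly_Mapping.keys p))"
  have "u @ replicate n E1 \<notin> Poly_Mapping.keys p" for u
  proof
    assume "u @ replicate n E1 \<in> Poly_Mapping.keys p"
    then have "length (u @ replicate n E1) \<le> Max (length ` Poly_Mapping.keys p)"
      by (intro Max_ge finite_imageI finite_keys imageI)
    then show False by (simp add: n_def)
  qed
  then have "(dl ^^ n) p = 0"
    by (intro ncpoly_eqI) (simp add: lk in_keys_iff)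
  then show ?thesis ..
qed

lemma ind_Nil: "ind [] = 1" and ind_Cons: "ind (a # k) = ee a * ind k"
  and ind_append: "ind (k @ l) = ind k * ind l"
  by (simp_all add: ind_def)

lemma ind_snoc: "ind (k @ [a]) = ind k * ee a"
  by (simp add: ind_def)

lemma ee_Suc_Suc: "ee (Suc (Suc n)) = ee (Suc n) * wd [E0]"
  by (simp add: ee_def mult.assoc power_Suc2 del: power_Suc)

lemma ee_1: "ee (Suc 0) = wd [E1]" by (simp add: ee_def)

text \<open>The guard excludes 0, where truncated subtraction makes \<open>ee 0\<close> equal to
  \<open>ee 1\<close>.\<close>

lemma dl_mult_ee: "a \<ge> 1 \<Longrightarrow> dl (p * ee a) = (if a = 1 then p else 0)"
proof -
  assume "a \<ge> 1"
  then consider "a = Suc 0" | n where "a = Suc (Suc n)" by (metis One_nat_def Suc_le_D not0_implies_Suc)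
  then show ?thesis
    by cases (simp_all add: ee_1, simp add: ee_Suc_Suc flip: mult.assoc)
qed

lemma ee_mult_H1 [simp, intro]: "p \<in> H1 \<Longrightarrow> ee a * p \<in> H1" "p \<in> H1 \<Longrightarrow> p * ee a \<in> H1"
proof -
  show "p \<in> H1 \<Longrightarrow> ee a * p \<in> H1"
    by (induction rule: H1_induct) (auto simp: distrib_left simp flip: ind_Cons)
  show "p \<in> H1 \<Longrightarrow> p * ee a \<in> H1"
    by (induction rule: H1_induct) (auto simp: distrib_right simp flip: ind_snoc)
qed

section \<open>The shuffle and the harmonic product\<close>

lemma shuffle_word_Nil [simp]: "shuffle_word v [] = wd v"
  by (cases v) auto

lemma shuffle_word_commute: "shuffle_word v w = shuffle_word w v"
  by (induction v w rule: shuffle_word.induct) (simp_all add: add.commute)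

lemma shuffle_one [simp]: "shuffle 1 p = p" "shuffle p 1 = p"
  by (induction p rule: ncpoly_induct) (simp_all add: shuffle_wd flip: wd_Nil)

lemma shuffle_commute: "shuffle p q = shuffle q p"
proof (induction p rule: ncpoly_induct)
  case (word v)
  show ?case
    by (induction q rule: ncpoly_induct) (simp_all add: shuffle_wd shuffle_word_commute)
qed simp_all

text \<open>With an arbitrary element \<open>p\<close> in place of a word, the recursion also
  applies when a factor is itself a product, as in associativity.\<close>

lemma shuffle_letter_left:
  "shuffle (wd [a] * p) (wd (c # w)) =
     wd [a] * shuffle p (wd (c # w)) + wd [c] * shuffle (wd [a] * p) (wd w)"
  by (induction p rule: ncpoly_induct)
    (simp_all add: shuffle_wd wd_mult distrib_left qsc_add add_ac)

lemma shuffle_letter_right: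
  "shuffle (wd (a # v)) (wd [c] * q) =
     wd [a] * shuffle (wd v) (wd [c] * q) + wd [c] * shuffle (wd (a # v)) q"
  by (subst (1 2 3) shuffle_commute) (simp add: shuffle_letter_left add.commute)

text \<open>Both bracketings expand into the same three terms, according to which of the three words
  supplies the first letter.\<close>

lemma shuffle_word_assoc: "shuffle (shuffle_word u v) (wd w) = shuffle (wd u) (shuffle_word v w)"
proof (induction "length u + length v + length w" arbitrary: u v w rule: less_induct)
  case less
  show ?case
  proof (cases "u = [] \<or> v = [] \<or> w = []")
    case True
    then show ?thesis by (auto simp: wd_Nil shuffle_wd)
  next
    case False
    then obtain a u' b v' c w' where uvw: "u = a # u'" "v = b # v'" "w = c # w'"
      by (meson neq_Nil_conv)
    have "shuffle (shuffle_word u v) (wd w) = wd [a] * shuffle (shuffle_word u' v) (wd w)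
        + wd [b] * shuffle (shuffle_word u v') (wd w) + wd [c] * shuffle (shuffle_word u v) (wd w')"
      by (simp add: uvw shuffle_letter_left distrib_left add_ac)
    also have "\<dots> = wd [a] * shuffle (wd u') (shuffle_word v w)
        + wd [b] * shuffle (wd u) (shuffle_word v' w) + wd [c] * shuffle (wd u) (shuffle_word v w')"
      using less[of u' v w] less[of u v' w] less[of u v w'] by (simp add: uvw)
    also have "\<dots> = shuffle (wd u) (shuffle_word v w)"
      by (simp add: uvw shuffle_letter_right distrib_left add_ac)
    finally show ?thesis .
  qed
qed

lemma shuffle_assoc: "shuffle (shuffle p q) r = shuffle p (shuffle q r)"
proof (induction p rule: ncpoly_induct)
  case (word u)
  show ?case
  proof (induction q rule: ncpoly_induct)
    case (word v)
    show ?case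
      by (induction r rule: ncpoly_induct) (simp_all add: shuffle_wd shuffle_word_assoc)
  qed simp_all
qed simp_all

text \<open>The defining recursion peels first letters, whereas \<open>dl\<close> sees last letters;
  the product obeys the same rule at that end.\<close>

lemma shuffle_word_snoc:
  "shuffle_word (v @ [a]) (w @ [b]) =
     shuffle_word v (w @ [b]) * wd [a] + shuffle_word (v @ [a]) w * wd [b]"
proof (induction "length v + length w" arbitrary: v w rule: less_induct)
  case less
  show ?case
  proof (cases v; cases w)
    fix c w' assume "v = []" "w = c # w'"
    then show ?thesis using less[of v w']
      by (simp add: wd_mult distrib_left distrib_right mult.assoc add_ac)
  next
    fix c v' assume "v = c # v'" "w = []"
    then show ?thesis using less[of v' w]
      by (simp add: wd_mult distrib_left distrib_right mult.assoc add_ac)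
  next
    fix c v' d w' assume "v = c # v'" "w = d # w'"
    then show ?thesis using less[of v' w] less[of v w']
      by (simp add: wd_mult distrib_left distrib_right mult.assoc add_ac)
  qed (simp_all add: wd_mult add.commute)
qed

lemma dl_wd: "dl (wd []) = 0" "dl (wd (w @ [a])) = (if a = E1 then wd w else 0)"
  by (simp_all add: dl_def)

lemma dl_shuffle: "dl (shuffle p q) = shuffle (dl p) q + shuffle p (dl q)"
proof (induction p rule: ncpoly_induct)
  case (word v)
  show ?case
  proof (induction q rule: ncpoly_induct)
    case (word w)
    show ?case
    proof (cases "v = [] \<or> w = []")
      case True
      then show ?thesis by (auto simp: wd_Nil shuffle_wd)
    next
      case False
      then obtain v' a w' b where "v = v' @ [a]" "w = w' @ [b]" by (meson rev_exhaust)
      then show ?thesis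
        by (cases a; cases b) (simp_all add: shuffle_wd dl_wd shuffle_word_snoc)
    qed
  qed (simp_all add: qsc_add add_ac)
qed (simp_all add: qsc_add add_ac)

lemma E1_mult_H1: "wd [E1] * p \<in> H1"
proof -
  have "wd [E1] * p = qsc 0 1 + wd [E1] * p" by simp
  then show ?thesis unfolding H1_def by blast
qed

lemma wd_H1: "wd w \<in> H1 \<longleftrightarrow> w = [] \<or> hd w = E1"
  by (simp add: H1_iff)

lemma shuffle_word_H1:
  "v = [] \<or> hd v = E1 \<Longrightarrow> w = [] \<or> hd w = E1 \<Longrightarrow> shuffle_word v w \<in> H1"
  by (cases v; cases w) (auto simp: E1_mult_H1 wd_H1)

lemma ncpoly_wordH1_induct [consumes 1, case_names zero word add qsc]:
  assumes "p \<in> H1" "R 0" "\<And>w. w = [] \<or> hd w = E1 \<Longrightarrow> R (wd w)"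
    and "\<And>p q. R p \<Longrightarrow> R q \<Longrightarrow> R (p + q)" "\<And>c p. R p \<Longrightarrow> R (qsc c p)"
  shows "R p"
  by (induction p rule: ncpoly_induct) (use assms in \<open>auto simp: H1_iff\<close>)

lemma shuffle_H1: "p \<in> H1 \<Longrightarrow> q \<in> H1 \<Longrightarrow> shuffle p q \<in> H1"
proof (induction p rule: ncpoly_wordH1_induct)
  case (word v)
  from word(2) show ?case
    by (induction q rule: ncpoly_wordH1_induct) (use word(1) in \<open>auto simp: shuffle_wd shuffle_word_H1\<close>)
qed auto

lemma is_index_simps [simp]:
  "is_index []" "is_index (a # k) \<longleftrightarrow> 1 \<le> a \<and> is_index k"
  "is_index (k @ l) \<longleftrightarrow> is_index k \<and> is_index l" "is_index (rev k) \<longleftrightarrow> is_index k"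
  by (auto simp: is_index_def)

lemma harmonic_ind_Nil [simp]: "harmonic_ind k [] = ind k"
  by (cases k) auto

lemma harmonic_ind_commute: "harmonic_ind k l = harmonic_ind l k"
  by (induction k l rule: harmonic_ind.induct) (simp_all add: add_ac)

lemma harmonic_ind_H1: "harmonic_ind k l \<in> H1"
  by (induction k l rule: harmonic_ind.induct) auto

lemma harmonic_H1: "p \<in> H1 \<Longrightarrow> q \<in> H1 \<Longrightarrow> harmonic p q \<in> H1"
proof (induction p rule: H1_induct)
  case (ind k)
  from ind(2) show ?case
    by (induction q rule: H1_induct) (use ind(1) in \<open>auto simp: harmonic_ind_ind harmonic_ind_H1\<close>)
qed auto

lemma harmonic_one [simp]:
  assumes "p \<in> H1" shows "harmonic 1 p = p" "harmonic p 1 = p"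
  using assms by (induction p rule: H1_induct) (simp_all add: harmonic_ind_ind flip: ind_Nil)

lemma harmonic_commute: "p \<in> H1 \<Longrightarrow> q \<in> H1 \<Longrightarrow> harmonic p q = harmonic q p"
proof (induction p rule: H1_induct)
  case (ind k)
  from ind(2) show ?case
    by (induction q rule: H1_induct) (use ind(1) in \<open>auto simp: harmonic_ind_ind harmonic_ind_commute\<close>)
qed auto

lemma harmonic_ee_left:
  assumes "p \<in> H1" "1 \<le> a" "1 \<le> c" "is_index w"
  shows "harmonic (ee a * p) (ind (c # w)) = ee a * harmonic p (ind (c # w))
    + ee c * harmonic (ee a * p) (ind w) + ee (a + c) * harmonic p (ind w)"
  using assms(1)
proof (induction p rule: H1_induct)
  case (ind k)
  then show ?case using assms(2-4)
    by (simp add: harmonic_ind_ind flip: ind_Cons)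
qed (simp_all add: distrib_left qsc_add add_ac)

lemma harmonic_ee_right:
  assumes "q \<in> H1" "1 \<le> a" "1 \<le> c" "is_index v"
  shows "harmonic (ind (a # v)) (ee c * q) = ee a * harmonic (ind v) (ee c * q)
    + ee c * harmonic (ind (a # v)) q + ee (a + c) * harmonic (ind v) q"
  using harmonic_ee_left[of q c a v] assms
  by (simp add: harmonic_commute[of "ind _"] add_ac)

text \<open>Both sides expand into seven terms, one for each nonempty set of first entries that are
  merged into the leading entry.\<close>

lemma harmonic_ind_assoc:
  "is_index u \<Longrightarrow> is_index v \<Longrightarrow> is_index w \<Longrightarrow>
   harmonic (harmonic_ind u v) (ind w) = harmonic (ind u) (harmonic_ind v w)"
proof (induction "length u + length v + length w" arbitrary: u v w rule: less_induct)
  case less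
  show ?case
  proof (cases "u = [] \<or> v = [] \<or> w = []")
    case True
    then show ?thesis using less.prems
      by (auto simp: ind_Nil harmonic_ind_H1 harmonic_ind_ind)
  next
    case False
    then obtain a u' b v' c w' where uvw: "u = a # u'" "v = b # v'" "w = c # w'"
      by (meson neq_Nil_conv)
    note pos = less.prems[unfolded uvw is_index_simps]
    have "harmonic (harmonic_ind u v) (ind w) = ee a * harmonic (harmonic_ind u' v) (ind w)
        + ee b * harmonic (harmonic_ind u v') (ind w) + ee c * harmonic (harmonic_ind u v) (ind w')
        + ee (a + b) * harmonic (harmonic_ind u' v') (ind w)
        + ee (a + c) * harmonic (harmonic_ind u' v) (ind w')
        + ee (b + c) * harmonic (harmonic_ind u v') (ind w')
        + ee (a + b + c) * harmonic (harmonic_ind u' v') (ind w')"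
      using pos by (simp add: uvw harmonic_ee_left harmonic_ind_H1 distrib_left add_ac)
    also have "\<dots> = ee a * harmonic (ind u') (harmonic_ind v w)
        + ee b * harmonic (ind u) (harmonic_ind v' w) + ee c * harmonic (ind u) (harmonic_ind v w')
        + ee (a + b) * harmonic (ind u') (harmonic_ind v' w)
        + ee (a + c) * harmonic (ind u') (harmonic_ind v w')
        + ee (b + c) * harmonic (ind u) (harmonic_ind v' w')
        + ee (a + b + c) * harmonic (ind u') (harmonic_ind v' w')"
      using less.hyps[of u' v w] less.hyps[of u v' w] less.hyps[of u v w'] less.hyps[of u' v' w]
        less.hyps[of u' v w'] less.hyps[of u v' w'] less.hyps[of u' v' w'] less.prems
      by (simp add: uvw)
    also have "\<dots> = harmonic (ind u) (harmonic_ind v w)"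
      using pos by (simp add: uvw harmonic_ee_right harmonic_ind_H1 distrib_left add_ac)
    finally show ?thesis .
  qed
qed

lemma harmonic_assoc:
  "p \<in> H1 \<Longrightarrow> q \<in> H1 \<Longrightarrow> r \<in> H1 \<Longrightarrow> harmonic (harmonic p q) r = harmonic p (harmonic q r)"
proof (induction p rule: H1_induct)
  case (ind u)
  from ind(2) show ?case
  proof (induction q rule: H1_induct)
    case v: (ind v)
    from ind(3) show ?case
      by (induction r rule: H1_induct)
        (use ind(1) v in \<open>auto simp: harmonic_ind_ind harmonic_ind_assoc\<close>)
  qed auto
qed auto

lemma harmonic_ind_snoc:
  "harmonic_ind (k @ [a]) (l @ [b]) =
     harmonic_ind k (l @ [b]) * ee a + harmonic_ind (k @ [a]) l * ee b + harmonic_ind k l * ee (a + b)"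
proof (induction "length k + length l" arbitrary: k l rule: less_induct)
  case less
  note alg = ind_Nil ind_Cons ind_append distrib_left distrib_right mult.assoc add_ac
  show ?case
  proof (cases k; cases l)
    fix c l' assume "k = []" "l = c # l'"
    then show ?thesis using less[of k l'] by (simp add: alg)
  next
    fix c k' assume "k = c # k'" "l = []"
    then show ?thesis using less[of k' l] by (simp add: alg)
  next
    fix c k' d l' assume "k = c # k'" "l = d # l'"
    then show ?thesis using less[of k' l] less[of k l'] less[of k' l'] by (simp add: alg)
  qed (simp_all add: alg)
qed

lemma harmonic_snoc:
  assumes "p \<in> H1" "is_index k" "1 \<le> a" "1 \<le> b"
  shows "harmonic (ind (k @ [a])) (p * ee b) = harmonic (ind k) (p * ee b) * ee a
    + harmonic (ind (k @ [a])) p * ee b + harmonic (ind k) p * ee (a + b)"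
  using assms(1)
proof (induction p rule: H1_induct)
  case (ind l)
  then show ?case using assms(2-4)
    by (simp add: harmonic_ind_ind harmonic_ind_snoc flip: ind_snoc)
qed (simp_all add: distrib_right qsc_add add_ac)

lemma dl_ind_snoc: "1 \<le> a \<Longrightarrow> dl (ind (k @ [a])) = (if a = 1 then ind k else 0)"
  by (simp add: ind_snoc dl_mult_ee)

text \<open>In the rule for last entries the merged entry \<open>a + b\<close> is at least 2 and
  therefore killed by \<open>dl\<close>; the other two terms give the Leibniz rule.\<close>

lemma dl_harmonic:
  "p \<in> H1 \<Longrightarrow> q \<in> H1 \<Longrightarrow> dl (harmonic p q) = harmonic (dl p) q + harmonic p (dl q)"
proof (induction p rule: H1_induct)
  case k: (ind k)
  from k(2) show ?case
  proof (induction q rule: H1_induct)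
    case l: (ind l)
    show ?case
    proof (cases "k = [] \<or> l = []")
      case True
      then show ?thesis by (auto simp: ind_Nil)
    next
      case False
      then obtain k' a l' b where kl: "k = k' @ [a]" "l = l' @ [b]" by (meson rev_exhaust)
      then have "1 \<le> a" "1 \<le> b" "is_index k'" "is_index l'" using k(1) l by auto
      then show ?thesis
        by (simp add: kl harmonic_ind_ind harmonic_ind_snoc dl_ind_snoc dl_mult_ee)
    qed
  qed (simp_all add: qsc_add add_ac)
qed (simp_all add: qsc_add add_ac)

section \<open>Regularization\<close>

text \<open>The laws common to the two products. Apart from bilinearity they are confined to
  \<open>H1\<close>, where \<open>harmonic\<close> is meaningful. Thanks to \<open>deriv\<close> one
  construction of the regularization serves both.\<close>

locale regularizable_product =
  fixes m :: "ncpoly \<Rightarrow> ncpoly \<Rightarrow> ncpoly" (infixl "\<diamondop>" 70)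
  assumes add_left: "(p + q) \<diamondop> r = p \<diamondop> r + q \<diamondop> r"
    and add_right: "p \<diamondop> (q + r) = p \<diamondop> q + p \<diamondop> r"
    and qsc_left: "qsc c p \<diamondop> q = qsc c (p \<diamondop> q)"
    and qsc_right: "p \<diamondop> qsc c q = qsc c (p \<diamondop> q)"
    and closed [simp, intro]: "p \<in> H1 \<Longrightarrow> q \<in> H1 \<Longrightarrow> p \<diamondop> q \<in> H1"
    and one_left [simp]: "p \<in> H1 \<Longrightarrow> 1 \<diamondop> p = p"
    and comm: "p \<in> H1 \<Longrightarrow> q \<in> H1 \<Longrightarrow> p \<diamondop> q = q \<diamondop> p"
    and assoc: "p \<in> H1 \<Longrightarrow> q \<in> H1 \<Longrightarrow> r \<in> H1 \<Longrightarrow> (p \<diamondop> q) \<diamondop> r = p \<diamondop> (q \<diamondop> r)"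
    and deriv: "p \<in> H1 \<Longrightarrow> q \<in> H1 \<Longrightarrow> dl (p \<diamondop> q) = dl p \<diamondop> q + p \<diamondop> dl q"
begin

lemma zero_left [simp]: "0 \<diamondop> p = 0" and zero_right [simp]: "p \<diamondop> 0 = 0"
  using qsc_left[of 0 0 p] qsc_right[of p 0 0] by simp_all

lemma diff_right: "p \<diamondop> (q - r) = p \<diamondop> q - p \<diamondop> r"
  using add_right[of p "q - r" r] by (simp add: algebra_simps)

lemma one_right [simp]: "p \<in> H1 \<Longrightarrow> p \<diamondop> 1 = p"
  using comm[of p 1] by simp

abbreviation "x \<equiv> wd [E1]"

lemma x_H1 [simp]: "x \<in> H1"
  by (simp add: wd_H1)

lemma dl_x [simp]: "dl x = 1"
  using dl_mult_letter(1)[of 1] by simp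

lemma H0_mult [simp]: "p \<in> H0 \<Longrightarrow> q \<in> H0 \<Longrightarrow> p \<diamondop> q \<in> H0"
  by (simp add: H0_iff_dl deriv)

lemma dl_pow_lin: "(dl ^^ n) 0 = 0" "(dl ^^ n) (p + q) = (dl ^^ n) p + (dl ^^ n) q"
    "(dl ^^ n) (qsc c p) = qsc c ((dl ^^ n) p)" "(dl ^^ n) (p - q) = (dl ^^ n) p - (dl ^^ n) q"
  by (induction n) simp_all

lemma dl_pow_H1 [simp]: "p \<in> H1 \<Longrightarrow> (dl ^^ n) p \<in> H1"
  by (induction n) auto

lemma dl_pow_H0: "p \<in> H0 \<Longrightarrow> (dl ^^ n) p = (if n = 0 then p else 0)"
  by (cases n) (simp_all add: H0_iff_dl funpow_swap1 dl_pow_lin)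

text \<open>Since \<open>dl x = 1\<close>, only two terms of the iterated Leibniz rule
  survive.\<close>

lemma dl_pow_x_mult:
  assumes "w \<in> H1"
  shows "(dl ^^ Suc n) (x \<diamondop> w) = qsc (of_nat (Suc n)) ((dl ^^ n) w) + x \<diamondop> (dl ^^ Suc n) w"
proof (induction n)
  case 0
  show ?case using assms by (simp add: deriv)
next
  case (Suc n)
  have "(dl ^^ Suc (Suc n)) (x \<diamondop> w) = dl ((dl ^^ Suc n) (x \<diamondop> w))" by simp
  also have "\<dots> = qsc (of_nat (Suc n)) ((dl ^^ Suc n) w) + dl (x \<diamondop> (dl ^^ Suc n) w)"
    unfolding Suc by simp
  also have "dl (x \<diamondop> (dl ^^ Suc n) w) = (dl ^^ Suc n) w + x \<diamondop> (dl ^^ Suc (Suc n)) w"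
    using deriv[of x "(dl ^^ Suc n) w"] dl_pow_H1[OF assms, of "Suc n"] by simp
  finally show ?case
    using qsc_add_left[of "of_nat (Suc n)" 1 "(dl ^^ Suc n) w"] by (simp add: add_ac)
qed

text \<open>Subtracting \<open>x \<diamondop> dl w / n\<close> removes the component of degree \<open>n\<close> in \<open>x\<close>, because
  \<open>\<lambda>w. x \<diamondop> dl w\<close> is the Euler operator.\<close>

lemma x_decomposition:
  "w \<in> H1 \<Longrightarrow> (dl ^^ Suc n) w = 0 \<Longrightarrow> \<exists>h\<in>H0. \<exists>w'\<in>H1. (dl ^^ n) w' = 0 \<and> w = h + x \<diamondop> w'"
proof (induction n arbitrary: w)
  case 0
  then have "w \<in> H0" by (simp add: H0_iff_dl)
  then show ?case by (intro bexI[of _ w] bexI[of _ 0]) auto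
next
  case (Suc n)
  define c :: rat where "c = 1 / of_nat (Suc n)"
  define v where "v = w - qsc c (x \<diamondop> dl w)"
  have "v \<in> H1" using Suc.prems by (simp add: v_def)
  moreover have "(dl ^^ Suc n) v = 0"
  proof -
    have "(dl ^^ Suc n) v = (dl ^^ Suc n) w - qsc c ((dl ^^ Suc n) (x \<diamondop> dl w))"
      unfolding v_def by (simp only: dl_pow_lin)
    also have "(dl ^^ Suc n) (x \<diamondop> dl w) = qsc (of_nat (Suc n)) ((dl ^^ Suc n) w) +
        x \<diamondop> (dl ^^ Suc (Suc n)) w"
      using dl_pow_x_mult[of "dl w" n] Suc.prems by (simp add: funpow_swap1)
    also have "qsc c (qsc (of_nat (Suc n)) ((dl ^^ Suc n) w) + x \<diamondop> (dl ^^ Suc (Suc n)) w) =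
        (dl ^^ Suc n) w"
      unfolding Suc.prems(2) by (simp add: c_def del: of_nat_Suc)
    finally show ?thesis by simp
  qed
  ultimately obtain h w' where h: "h \<in> H0" "w' \<in> H1" "(dl ^^ n) w' = 0" "v = h + x \<diamondop> w'"
    using Suc.IH by blast
  have "w = h + x \<diamondop> (w' + qsc c (dl w))"
    using h(4) by (simp add: v_def add_right qsc_right algebra_simps)
  moreover have "(dl ^^ Suc n) (w' + qsc c (dl w)) = 0"
  proof -
    have "(dl ^^ Suc n) (dl w) = 0" using Suc.prems(2) by (simp add: funpow_swap1)
    moreover have "(dl ^^ Suc n) w' = 0" using h(3) by simp
    ultimately show ?thesis by (simp only: dl_pow_lin) simp
  qed
  moreover have "w' + qsc c (dl w) \<in> H1" using h Suc.prems by auto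
  ultimately show ?case using h(1) by blast
qed

text \<open>If \<open>w\<close> were nonzero, take the least \<open>n\<close> with
  \<open>(dl ^^ n) w = 0\<close>. Applying \<open>dl ^^ n\<close> to the equation kills
  \<open>h\<close> and leaves \<open>n\<close> times the nonzero
  \<open>(dl ^^ (n - 1)) w\<close>.\<close>

lemma x_decomposition_unique:
  assumes "h \<in> H0" "w \<in> H1" "h + x \<diamondop> w = 0"
  shows "h = 0"
proof -
  have "w = 0"
  proof (rule ccontr)
    assume "w \<noteq> 0"
    define n where "n = (LEAST n. (dl ^^ n) w = 0)"
    have n: "(dl ^^ n) w = 0" unfolding n_def using dl_nilpotent by (rule LeastI_ex)
    then obtain k where k: "n = Suc k" using \<open>w \<noteq> 0\<close> by (cases n) auto
    have "(dl ^^ k) w \<noteq> 0"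
      using not_less_Least[of k "\<lambda>n. (dl ^^ n) w = 0"] k n_def by auto
    have "0 = (dl ^^ Suc k) (h + x \<diamondop> w)" unfolding assms(3) by (simp only: dl_pow_lin)
    also have "\<dots> = (dl ^^ Suc k) h + (dl ^^ Suc k) (x \<diamondop> w)" by (simp only: dl_pow_lin)
    also have "\<dots> = qsc (of_nat (Suc k)) ((dl ^^ k) w)"
      using dl_pow_H0[OF assms(1), of "Suc k"] dl_pow_x_mult[OF assms(2), of k] n k
      by (simp del: of_nat_Suc funpow.simps)
    finally have "qsc (1 / of_nat (Suc k)) (qsc (of_nat (Suc k)) ((dl ^^ k) w)) = 0"
      by (metis qsc_0(1))
    then show False using \<open>(dl ^^ k) w \<noteq> 0\<close> by (simp del: of_nat_Suc)
  qed
  then show ?thesis using assms(3) by simp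
qed

text \<open>The constant term of \<open>w\<close>, read as a polynomial in \<open>x\<close> with
  coefficients in \<open>H0\<close>.\<close>

definition reg :: "ncpoly \<Rightarrow> ncpoly" where
  "reg w = (THE h. h \<in> H0 \<and> (\<exists>w'\<in>H1. w = h + x \<diamondop> w'))"

lemma reg_eq: "h \<in> H0 \<Longrightarrow> w' \<in> H1 \<Longrightarrow> reg (h + x \<diamondop> w') = h"
  unfolding reg_def
proof (rule the_equality)
  fix h' assume h: "h \<in> H0" "w' \<in> H1" and "h' \<in> H0 \<and> (\<exists>v\<in>H1. h + x \<diamondop> w' = h' + x \<diamondop> v)"
  then obtain v where v: "h' \<in> H0" "v \<in> H1" "h + x \<diamondop> w' = h' + x \<diamondop> v" by blast
  then have "(h - h') + x \<diamondop> (w' - v) = 0" by (simp add: diff_right algebra_simps)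
  then have "h - h' = 0" using x_decomposition_unique[of "h - h'" "w' - v"] h v(1,2) by blast
  then show "h' = h" by simp
qed blast

lemma reg_decomposition:
  assumes "w \<in> H1"
  obtains w' where "reg w \<in> H0" "w' \<in> H1" "w = reg w + x \<diamondop> w'"
proof -
  obtain n where "(dl ^^ n) w = 0" using dl_nilpotent by blast
  then have "(dl ^^ Suc n) w = 0" by simp
  then obtain h w' where "h \<in> H0" "w' \<in> H1" "w = h + x \<diamondop> w'"
    using x_decomposition[OF assms] by blast
  then show ?thesis using that reg_eq by metis
qed

lemma reg_H0: "h \<in> H0 \<Longrightarrow> reg h = h"
  using reg_eq[of h 0] by simp

lemma reg_in_H0 [simp]: "w \<in> H1 \<Longrightarrow> reg w \<in> H0"
  by (erule reg_decomposition)

lemma reg_x: "reg x = 0"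
  using reg_eq[of 0 1] by simp

lemma reg_add:
  assumes "v \<in> H1" "w \<in> H1" shows "reg (v + w) = reg v + reg w"
proof -
  obtain v' where v: "reg v \<in> H0" "v' \<in> H1" "v = reg v + x \<diamondop> v'" using assms reg_decomposition by blast
  obtain w' where w: "reg w \<in> H0" "w' \<in> H1" "w = reg w + x \<diamondop> w'" using assms reg_decomposition by blast
  have "v + w = (reg v + reg w) + x \<diamondop> (v' + w')"
    using v(3) w(3) by (simp add: add_right algebra_simps)
  then show ?thesis using v w reg_eq[of "reg v + reg w" "v' + w'"] by simp
qed

lemma reg_qsc:
  assumes "v \<in> H1" shows "reg (qsc c v) = qsc c (reg v)"
proof -
  obtain v' where v: "reg v \<in> H0" "v' \<in> H1" "v = reg v + x \<diamondop> v'" using assms reg_decomposition by blast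
  have "qsc c v = qsc c (reg v) + x \<diamondop> qsc c v'"
    using v(3) by (metis qsc_add qsc_right)
  then show ?thesis using v reg_eq[of "qsc c (reg v)" "qsc c v'"] by simp
qed

text \<open>The multiples of \<open>x\<close> form an ideal of \<open>H1\<close>, and
  \<open>H0\<close> is a subalgebra that complements it.\<close>

lemma reg_mult:
  assumes "v \<in> H1" "w \<in> H1" shows "reg (v \<diamondop> w) = reg v \<diamondop> reg w"
proof -
  obtain v' where v: "reg v \<in> H0" "v' \<in> H1" "v = reg v + x \<diamondop> v'" using assms reg_decomposition by blast
  obtain w' where w: "reg w \<in> H0" "w' \<in> H1" "w = reg w + x \<diamondop> w'" using assms reg_decomposition by blast
  have H1: "reg v \<in> H1" "reg w \<in> H1" using v w by (auto intro: H0_subset_H1)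
  have "v \<diamondop> w = reg v \<diamondop> w + (x \<diamondop> v') \<diamondop> w"
    using v(3) by (metis add_left)
  also have "reg v \<diamondop> w = reg v \<diamondop> reg w + reg v \<diamondop> (x \<diamondop> w')"
    using w(3) by (metis add_right)
  also have "reg v \<diamondop> (x \<diamondop> w') = x \<diamondop> (reg v \<diamondop> w')"
    using H1 w(2) by (metis assoc comm x_H1)
  also have "(x \<diamondop> v') \<diamondop> w = x \<diamondop> (v' \<diamondop> w)" using v assms by (simp add: assoc)
  finally have "v \<diamondop> w = reg v \<diamondop> reg w + x \<diamondop> (reg v \<diamondop> w' + v' \<diamondop> w)"
    by (simp add: add_right add_ac)
  then show ?thesis using v w H1 assms reg_eq[of "reg v \<diamondop> reg w" "reg v \<diamondop> w' + v' \<diamondop> w"] by simp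
qed

end

section \<open>Extension of a character of \<open>H0\<close> to polynomials in T\<close>

locale regularizable_character = regularizable_product +
  fixes Z :: "ncpoly \<Rightarrow> real"
  assumes Z_add: "p \<in> H0 \<Longrightarrow> q \<in> H0 \<Longrightarrow> Z (p + q) = Z p + Z q"
    and Z_qsc: "p \<in> H0 \<Longrightarrow> Z (qsc c p) = of_rat c * Z p"
    and Z_mult: "p \<in> H0 \<Longrightarrow> q \<in> H0 \<Longrightarrow> Z (p \<diamondop> q) = Z p * Z q"
    and Z_one: "Z 1 = 1"
begin

lemma Z_zero: "Z 0 = 0"
  using Z_qsc[of 0 0] by simp

text \<open>Taylor's formula with \<open>dl\<close> in the role of d/dT and \<open>reg\<close> as
  evaluation at T = 0. The bound merely makes the sum finite: all later derivatives of
  \<open>w\<close> vanish.\<close>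

definition F :: "ncpoly \<Rightarrow> real poly" where
  "F w = (\<Sum>i<(LEAST n. (dl ^^ n) w = 0). monom (Z (reg ((dl ^^ i) w)) / fact i) i)"

lemma coeff_F: "coeff (F w) i = Z (reg ((dl ^^ i) w)) / fact i"
proof -
  define n where "n = (LEAST n. (dl ^^ n) w = 0)"
  have n: "(dl ^^ n) w = 0" unfolding n_def using dl_nilpotent by (rule LeastI_ex)
  have "coeff (F w) i = (\<Sum>j<n. if j = i then Z (reg ((dl ^^ j) w)) / fact j else 0)"
    unfolding F_def n_def[symmetric] by (simp add: coeff_sum)
  also have "\<dots> = (if i < n then Z (reg ((dl ^^ i) w)) / fact i else 0)"
    by (simp add: sum.delta)
  also have "\<dots> = Z (reg ((dl ^^ i) w)) / fact i"
  proof (cases "i < n")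
    case False
    then have "(dl ^^ i) w = (dl ^^ (i - n)) ((dl ^^ n) w)"
      by (simp flip: funpow_add[unfolded o_def fun_eq_iff, rule_format])
    then show ?thesis using False n by (simp add: dl_pow_lin reg_H0 Z_zero)
  qed simp
  finally show ?thesis .
qed

lemma F_add: "p \<in> H1 \<Longrightarrow> q \<in> H1 \<Longrightarrow> F (p + q) = F p + F q"
  by (rule poly_eqI) (simp add: coeff_F dl_pow_lin reg_add Z_add add_divide_distrib)

lemma F_qsc: "p \<in> H1 \<Longrightarrow> F (qsc c p) = smult (of_rat c) (F p)"
  by (rule poly_eqI) (simp add: coeff_F dl_pow_lin reg_qsc Z_qsc)

lemma pderiv_F: "pderiv (F w) = F (dl w)"
proof (rule poly_eqI)
  fix i
  have "real (Suc i) * (y / fact (Suc i)) = y / fact i" for y by (simp del: of_nat_Suc)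
  then show "coeff (pderiv (F w)) i = coeff (F (dl w)) i"
    by (simp add: coeff_pderiv coeff_F funpow_swap1 del: of_nat_Suc fact_Suc)
qed

lemma F_H0: "p \<in> H0 \<Longrightarrow> F p = [:Z p:]"
  by (rule poly_eqI) (auto simp: coeff_F dl_pow_H0 reg_H0 Z_zero coeff_pCons split: nat.splits)

lemma F_x: "F x = [:0, 1:]"
proof -
  have "pderiv (F x - [:0, 1:]) = 0"
    by (simp only: pderiv_diff pderiv_F dl_x F_H0[OF H0_closed(2)] Z_one) (simp add: pderiv_pCons)
  then obtain c where "F x - [:0, 1:] = [:c:]"
    by (metis degree_eq_zeroE pderiv_eq_0_iff)
  then have *: "F x = [:c, 1:]" by (simp add: algebra_simps)
  have "coeff (F x) 0 = 0" using reg_x by (simp add: coeff_F Z_zero)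
  then show ?thesis using * by simp
qed

text \<open>By the Leibniz rule and induction on the orders of vanishing both sides have the same
  derivative, and their constant terms agree because \<open>reg\<close> and \<open>Z\<close> are
  multiplicative.\<close>

lemma F_mult_aux:
  "v \<in> H1 \<Longrightarrow> w \<in> H1 \<Longrightarrow> (dl ^^ a) v = 0 \<Longrightarrow> (dl ^^ b) w = 0 \<Longrightarrow> F (v \<diamondop> w) = F v * F w"
proof (induction "a + b" arbitrary: a b v w rule: less_induct)
  case less
  show ?case
  proof (cases "a = 0 \<or> b = 0")
    case True
    then show ?thesis using less.prems F_H0[of 0] by (auto simp: Z_zero)
  next
    case False
    then obtain a' b' where ab: "a = Suc a'" "b = Suc b'" by (meson not0_implies_Suc)
    have 1: "F (dl v \<diamondop> w) = F (dl v) * F w"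
      by (rule less.hyps[of a' b]) (use less.prems ab in \<open>auto simp: funpow_swap1\<close>)
    have 2: "F (v \<diamondop> dl w) = F v * F (dl w)"
      by (rule less.hyps[of a b']) (use less.prems ab in \<open>auto simp: funpow_swap1\<close>)
    have "pderiv (F (v \<diamondop> w) - F v * F w) = 0"
      using less.prems by (simp add: pderiv_diff pderiv_F deriv F_add 1 2 pderiv_mult)
    then obtain c where c: "F (v \<diamondop> w) - F v * F w = [:c:]"
      by (metis degree_eq_zeroE pderiv_eq_0_iff)
    then have "c = coeff (F (v \<diamondop> w)) 0 - coeff (F v) 0 * coeff (F w) 0"
      by (metis coeff_diff coeff_pCons_0 coeff_mult_0)
    also have "\<dots> = 0" using less.prems by (simp add: coeff_F reg_mult Z_mult)
    finally show ?thesis using c by simp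
  qed
qed

lemma F_mult: "v \<in> H1 \<Longrightarrow> w \<in> H1 \<Longrightarrow> F (v \<diamondop> w) = F v * F w"
  using F_mult_aux dl_nilpotent by metis

lemma is_regularization_F: "is_regularization m Z (\<lambda>p. if p \<in> H1 then F p else 0)"
  using F_H0[OF H0_closed(2)]
  by (simp add: is_regularization_def F_add F_qsc F_mult F_H0 F_x ee_1 Z_one H0_subset_H1 flip: pCons_one)

lemma is_regularization_unique:
  assumes f: "is_regularization m Z f" and g: "is_regularization m Z g"
  shows "f = g"
proof
  fix w
  have *: "f v = g v" if "v \<in> H1" "(dl ^^ n) v = 0" for v n
    using that
  proof (induction n arbitrary: v)
    case 0
    then show ?case using f g H0_closed(1) by (simp add: is_regularization_def ee_1)
  next
    case (Suc n)
    \<comment> \<open>Any regularization is determined at \<open>v\<close> by \<open>Z h\<close> and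
      by its value at \<open>v'\<close>, an element of smaller order.\<close>
    then obtain h v' where h: "h \<in> H0" "v' \<in> H1" "(dl ^^ n) v' = 0" "v = h + x \<diamondop> v'"
      using x_decomposition[OF Suc.prems] by blast
    have "r v = [:Z h:] + [:0, 1:] * r v'" if "is_regularization m Z r" for r
      using that h(1,2) H0_subset_H1[of h] unfolding is_regularization_def h(4)
      by (simp add: ee_1)
    then show ?case using f g Suc.IH[OF h(2,3)] by metis
  qed
  show "f w = g w"
  proof (cases "w \<in> H1")
    case True
    then show ?thesis using * dl_nilpotent by blast
  next
    case False
    then show ?thesis using f g by (simp add: is_regularization_def ee_1)
  qed
qed

lemma regularization_eq: "regularization m Z = (\<lambda>p. if p \<in> H1 then F p else 0)"
  unfolding regularization_def
  using is_regularization_F is_regularization_unique by (auto intro!: the_equality)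

end

section \<open>The star recursion\<close>

context regularizable_product
begin

text \<open>\<open>H k l\<close> is the part of the product of $\mathbf{k}$ with the star element of $\mathbf{l}$ on which
  $n_s \le m_r$ (in the poset: $b_{s,1} < a_K$). The list \<open>l\<close> holds the entries of $\mathbf{l}$ from
  the last to the first.\<close>

primrec H :: "nat list \<Rightarrow> nat list \<Rightarrow> ncpoly" where
  "H k [] = ind k"
| "H k (a # l) = ind k \<diamondop> H [a] l - H (k @ [a]) l"

text \<open>The common form of the two star elements: \<open>star_eq_S\<close> treats the harmonic
  product, \<open>W_P_eq_S\<close> the shuffle product.\<close>

primrec S :: "nat list \<Rightarrow> ncpoly" where
  "S [] = 1"
| "S (a # l) = H [a] l"

lemma H_H1 [simp]: "H k l \<in> H1"
  by (induction l arbitrary: k) auto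

lemma S_H1 [simp]: "S l \<in> H1"
  by (cases l) auto

text \<open>In the recursion for \<open>H (k @ [a]) (b # l)\<close> the derivative of the factor
  \<open>H [b] l\<close> cancels against that of the subtracted, longer term, so only the last entry
  \<open>a\<close> of the first argument matters.\<close>

lemma dl_H:
  "is_index l \<Longrightarrow> 1 \<le> a \<Longrightarrow> dl (H (k @ [a]) l) = (if a = 1 then ind k \<diamondop> S l else 0)"
proof (induction l arbitrary: k a)
  case Nil
  then show ?case by (simp add: dl_ind_snoc)
next
  case (Cons b l)
  have "dl (H (k @ [a]) (b # l)) = dl (ind (k @ [a])) \<diamondop> H [b] l + ind (k @ [a]) \<diamondop> dl (H ([] @ [b]) l)
      - dl (H ((k @ [a]) @ [b]) l)"
    by (simp add: deriv)
  also have "\<dots> = dl (ind (k @ [a])) \<diamondop> H [b] l"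
    using Cons.prems Cons.IH[of b "[]"] Cons.IH[of b "k @ [a]"] by (simp add: ind_Nil)
  finally show ?case using Cons.prems by (simp add: dl_ind_snoc)
qed

lemma H_admissible_H0: "is_index l \<Longrightarrow> 2 \<le> e \<Longrightarrow> H (k @ [e]) l \<in> H0"
  using dl_H[of l e k] by (simp add: H0_iff_dl)

lemma dl_S: "is_index l \<Longrightarrow> dl (S l) = (case l of [] \<Rightarrow> 0 | a # l' \<Rightarrow> if a = 1 then S l' else 0)"
  using dl_H[of _ _ "[]"] by (cases l) (auto simp: ind_Nil)

end

interpretation sh: regularizable_product shuffle
  by standard (simp_all add: shuffle_H1 shuffle_assoc dl_shuffle, rule shuffle_commute)

interpretation har: regularizable_product harmonic
  by standard (simp_all add: harmonic_H1 harmonic_assoc dl_harmonic, rule harmonic_commute)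

text \<open>Here terms are grouped by their last entry: \<open>e\<close> absorbs the leading entries
  of \<open>l\<close> that are merged into it, and the remaining ones form a star element that is
  multiplied with \<open>k\<close>. For empty \<open>k\<close> this is a star element itself; for
  \<open>e = c + d\<close> it is a circledast product.\<close>

primrec star_sum :: "nat list \<Rightarrow> nat \<Rightarrow> nat list \<Rightarrow> ncpoly" where
  "star_sum k e [] = ind (k @ [e])"
| "star_sum k e (b # l) = harmonic (ind k) (star_sum [] b l) * ee e + star_sum k (e + b) l"

lemma star_sum_H1 [simp]: "star_sum k e l \<in> H1"
  by (induction l arbitrary: k e) (auto simp: harmonic_H1)

text \<open>The last entry of an index belongs to the largest summation variable. In the first term
  the largest variable of the star factor is at most that of \<open>k @ [e]\<close>, in the second
  term it exceeds it.\<close>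

lemma harmonic_star_sum:
  "is_index k \<Longrightarrow> 1 \<le> e \<Longrightarrow> 1 \<le> b \<Longrightarrow> is_index l \<Longrightarrow>
   harmonic (ind (k @ [e])) (star_sum [] b l) = star_sum k e (b # l) + star_sum (k @ [e]) b l"
proof (induction l arbitrary: b)
  case Nil
  moreover have "ind [b] = ee b" by (simp add: ind_def)
  ultimately show ?case
    using harmonic_snoc[of 1 k e b] by (simp add: add_ac flip: ind_snoc)
next
  case (Cons a l)
  let ?S = "star_sum [] a l" and ?T = "star_sum [] (b + a) l"
  have "harmonic (ind (k @ [e])) (star_sum [] b (a # l)) =
      harmonic (ind (k @ [e])) (?S * ee b) + harmonic (ind (k @ [e])) ?T"
    by (simp add: ind_Nil)
  also have "harmonic (ind (k @ [e])) (?S * ee b) = harmonic (ind k) (?S * ee b) * ee e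
      + harmonic (ind (k @ [e])) ?S * ee b + harmonic (ind k) ?S * ee (e + b)"
    using Cons.prems by (intro harmonic_snoc) auto
  also have "harmonic (ind (k @ [e])) ?T = star_sum k e ((b + a) # l) + star_sum (k @ [e]) (b + a) l"
    using Cons.prems by (intro Cons.IH) auto
  finally show ?case by (simp add: ind_Nil distrib_right add_ac)
qed

lemma star_sum_eq_H:
  "is_index k \<Longrightarrow> 1 \<le> e \<Longrightarrow> is_index l \<Longrightarrow> star_sum k e l = har.H (k @ [e]) l"
proof (induction l arbitrary: k e)
  case (Cons b l)
  have "har.H (k @ [e]) (b # l) =
      harmonic (ind (k @ [e])) (har.H ([] @ [b]) l) - har.H ((k @ [e]) @ [b]) l"
    by simp
  also have "\<dots> = harmonic (ind (k @ [e])) (star_sum [] b l) - star_sum (k @ [e]) b l"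
    using Cons.prems Cons.IH[of "[]" b] Cons.IH[of "k @ [e]" b] by simp
  also have "\<dots> = star_sum k e (b # l)"
    using Cons.prems harmonic_star_sum[of k e b l] by simp
  finally show ?case ..
qed simp

lemma star_Nil: "star [] = 1" and star_single: "star [a] = ee a"
  and star_Cons: "star (a # b # l) = ee a * star (b # l) + star ((a + b) # l)"
proof -
  have "sum_list (map ind (map ((#) a) xs)) = ee a * sum_list (map ind xs)" for xs
    by (induction xs) (simp_all add: ind_Cons distrib_left)
  then show "star (a # b # l) = ee a * star (b # l) + star ((a + b) # l)"
    by (simp add: star_def)
qed (simp_all add: star_def ind_def)

text \<open>\<open>merges\<close> works from the front; the harmonic recursion for \<open>H\<close>
  needs the same rule at the end of the index.\<close>

lemma star_snoc: "star (l @ [b, d]) = star (l @ [b]) * ee d + star (l @ [b + d])"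
proof (induction "length l" arbitrary: l rule: less_induct)
  case less
  consider "l = []" | a where "l = [a]" | a b' l' where "l = a # b' # l'"
    by (metis list.exhaust)
  then show ?case
  proof cases
    case 3
    then show ?thesis using less[of "b' # l'"] less[of "(a + b') # l'"]
      by (simp add: star_Cons distrib_left distrib_right mult.assoc add_ac)
  qed (simp_all add: star_Cons star_single distrib_left distrib_right mult.assoc add_ac)
qed

lemma star_rev_Cons: "star (rev l @ [b]) = star_sum [] b l"
proof (induction l arbitrary: b)
  case (Cons a l)
  have "star (rev (a # l) @ [b]) = star (rev l @ [a]) * ee b + star (rev l @ [a + b])"
    using star_snoc[of "rev l" a b] by simp
  then show ?case by (simp add: Cons ind_Nil add.commute)
qed (simp add: star_single ind_def)

lemma star_eq_S: "is_index l \<Longrightarrow> star l = har.S (rev l)"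
proof (cases l rule: rev_cases)
  case (snoc l' b)
  moreover assume "is_index l"
  ultimately show ?thesis
    using star_rev_Cons[of "rev l'" b] star_sum_eq_H[of "[]" b "rev l'"] by simp
qed (simp add: star_Nil)

lemma circledast_snoc:
  assumes "p \<in> H1" "is_index k" "1 \<le> c" "1 \<le> d"
  shows "circledast (ind (k @ [c])) (p * ee d) = harmonic (ind k) p * ee (c + d)"
  using assms(1)
proof (induction p rule: H1_induct)
  case (ind l)
  have "circledast (ind (k @ [c])) (ind (l @ [d])) = harmonic_ind k l * ee (c + d)"
    using ind assms(2-4) by (simp add: circledast_def ind_eq_wd bilin_wd index_of_index_word)
  then show ?case using ind assms(2) by (simp add: ind_snoc harmonic_ind_ind)
qed (simp_all add: circledast_def bilin_add_right bilin_qsc_right bilin_0_right distrib_right)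

lemma circledast_star_sum:
  "is_index k \<Longrightarrow> 1 \<le> c \<Longrightarrow> 1 \<le> d \<Longrightarrow> is_index l \<Longrightarrow>
   circledast (ind (k @ [c])) (star (rev l @ [d])) = star_sum k (c + d) l"
proof (induction l arbitrary: d)
  case Nil
  then show ?case using circledast_snoc[of 1 k c d] by (simp add: star_single ind_snoc)
next
  case (Cons a l)
  have "circledast (ind (k @ [c])) (star (rev (a # l) @ [d])) =
      circledast (ind (k @ [c])) (star_sum [] a l * ee d) + star_sum k (c + (a + d)) l"
    using Cons.IH[of "a + d"] Cons.prems star_snoc[of "rev l" a d]
    by (simp add: circledast_def bilin_add_right star_rev_Cons)
  then show ?case using Cons.prems by (simp add: circledast_snoc add_ac)
qed

text \<open>As in \<open>mu_eq_H\<close>, the last entries \<open>c\<close> and \<open>d\<close> are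
  fused into one, and both sides of (Int-Ser) become values of the same recursion.\<close>

lemma circledast_star:
  "is_index k \<Longrightarrow> 1 \<le> c \<Longrightarrow> 1 \<le> d \<Longrightarrow> is_index l \<Longrightarrow>
   circledast (ind (k @ [c])) (star (l @ [d])) = har.H (k @ [c + d]) (rev l)"
  using circledast_star_sum[of k c d "rev l"] star_sum_eq_H[of k "c + d" "rev l"] by simp

section \<open>Linear extensions\<close>

text \<open>The condition is imposed on a generating relation rather than on its closure, so that
  orders can be built by inserting pairs and by forming unions.\<close>

definition lin_exts :: "'a set \<Rightarrow> ('a \<times> 'a) set \<Rightarrow> 'a list set" where
  "lin_exts A r = {xs. distinct xs \<and> set xs = A \<and> sorted_wrt (\<lambda>x y. (y, x) \<notin> r) xs}"

definition lin_ext_sum :: "'a set \<Rightarrow> ('a \<times> 'a) set \<Rightarrow> ('a \<Rightarrow> letter) \<Rightarrow> ncpoly" where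
  "lin_ext_sum A r f = (\<Sum>xs\<in>lin_exts A r. wd (map f xs))"

lemma finite_lin_exts: "finite A \<Longrightarrow> finite (lin_exts A r)"
  by (rule finite_subset[OF _ finite_subset_distinct[of A]]) (auto simp: lin_exts_def)

text \<open>Inequality of positions is transitive, so it passes from the generators to their
  closure; \<open>r\<close> stays within the carrier, so intermediate elements do have a
  position.\<close>

lemma linear_extensions_eq:
  assumes "le X = generated_order (carr X) r" "r \<subseteq> carr X \<times> carr X"
  shows "linear_extensions X = lin_exts (carr X) r"
proof -
  have "(\<forall>i<length xs. \<forall>j<length xs. (xs ! i, xs ! j) \<in> le X \<longrightarrow> i \<le> j) \<longleftrightarrow>
      sorted_wrt (\<lambda>x y. (y, x) \<notin> r) xs" if xs: "distinct xs" "set xs = carr X" for xs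
  proof
    assume *: "\<forall>i<length xs. \<forall>j<length xs. (xs ! i, xs ! j) \<in> le X \<longrightarrow> i \<le> j"
    show "sorted_wrt (\<lambda>x y. (y, x) \<notin> r) xs"
      unfolding sorted_wrt_iff_nth_less
    proof (intro allI impI notI)
      fix i j assume ij: "i < j" "j < length xs" "(xs ! j, xs ! i) \<in> r"
      then have "(xs ! j, xs ! i) \<in> le X" by (auto simp: assms(1) generated_order_def)
      then show False using * ij by (meson le_less_trans less_imp_le_nat linorder_not_le)
    qed
  next
    assume s: "sorted_wrt (\<lambda>x y. (y, x) \<notin> r) xs"
    have one: "i \<le> j" if "i < length xs" "j < length xs" "(xs ! i, xs ! j) \<in> r" for i j
      using s that unfolding sorted_wrt_iff_nth_less by (metis linorder_not_less)
    have tr: "\<forall>i<length xs. \<forall>j<length xs. xs ! i = x \<longrightarrow> xs ! j = y \<longrightarrow> i \<le> j"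
      if "(x, y) \<in> r\<^sup>+" for x y
      using that
    proof (induction rule: trancl_induct)
      case (base y)
      then show ?case using one by blast
    next
      case (step y z)
      then obtain k where "k < length xs" "xs ! k = y"
        using assms(2) xs(2) by (metis SigmaD1 in_set_conv_nth subsetD)
      then show ?case using step.IH step.hyps(2) one by (metis order_trans)
    qed
    show "\<forall>i<length xs. \<forall>j<length xs. (xs ! i, xs ! j) \<in> le X \<longrightarrow> i \<le> j"
      using tr xs(1) unfolding assms(1) generated_order_def
      by (auto simp: nth_eq_iff_index_eq)
  qed
  then show ?thesis by (auto simp: linear_extensions_def lin_exts_def)
qed

lemma W_eq_lin_ext_sum:
  "le X = generated_order (carr X) r \<Longrightarrow> r \<subseteq> carr X \<times> carr X \<Longrightarrow>
   W X = lin_ext_sum (carr X) r (lab X)"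
  by (simp add: W_def lin_ext_sum_def linear_extensions_eq)

text \<open>Every linear extension puts one of the two elements before the other.\<close>

lemma lin_ext_sum_split:
  assumes "finite A" "x \<in> A" "y \<in> A" "x \<noteq> y"
  shows "lin_ext_sum A r f = lin_ext_sum A (insert (x, y) r) f + lin_ext_sum A (insert (y, x) r) f"
proof -
  define B where "B u v xs \<longleftrightarrow> sorted_wrt (\<lambda>a b. \<not> (b = u \<and> a = v)) xs" for u v :: 'a and xs
  have ins: "sorted_wrt (\<lambda>a b. (b, a) \<notin> insert (u, v) r) xs \<longleftrightarrow>
      sorted_wrt (\<lambda>a b. (b, a) \<notin> r) xs \<and> B u v xs" for u v xs
    unfolding B_def sorted_wrt_iff_nth_less by auto
  have "B x y xs \<longleftrightarrow> \<not> B y x xs" if xs: "distinct xs" "set xs = A" for xs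
  proof -
    obtain i j where ij: "i < length xs" "j < length xs" "xs ! i = x" "xs ! j = y"
      using assms xs by (metis in_set_conv_nth)
    then have "i \<noteq> j" using assms by auto
    have "B x y xs \<longleftrightarrow> \<not> j < i" "B y x xs \<longleftrightarrow> \<not> i < j"
      unfolding B_def sorted_wrt_iff_nth_less using ij xs(1)
      by (metis nth_eq_iff_index_eq less_trans)+
    then show ?thesis using \<open>i \<noteq> j\<close> by auto
  qed
  then have "lin_exts A r = lin_exts A (insert (x, y) r) \<union> lin_exts A (insert (y, x) r)"
    "lin_exts A (insert (x, y) r) \<inter> lin_exts A (insert (y, x) r) = {}"
    unfolding lin_exts_def ins by auto
  then show ?thesis
    unfolding lin_ext_sum_def using finite_lin_exts[OF assms(1)] by (simp add: sum.union_disjoint)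
qed

lemma sorted_wrt_filterI:
  assumes "r \<subseteq> A \<times> A" "sorted_wrt (\<lambda>x y. (y, x) \<notin> r) (filter (\<lambda>x. x \<in> A) xs)"
  shows "sorted_wrt (\<lambda>x y. (y, x) \<notin> r) xs"
  using assms(2) by (induction xs) (use assms(1) in \<open>auto split: if_splits\<close>)

text \<open>\<open>shuffles\<close> is a set, while the shuffle product counts multiplicities. For
  disjoint lists each interleaving arises only once, and repetitions appear only after applying
  \<open>f\<close>, inside the sum.\<close>

lemma sum_shuffles:
  "set us \<inter> set vs = {} \<Longrightarrow>
   (\<Sum>xs\<in>shuffles us vs. wd (map f xs)) = shuffle_word (map f us) (map f vs)"
proof (induction us vs rule: shuffles.induct)
  case (3 x xs y ys)
  have "(\<Sum>zs\<in>(#) a ` Y. wd (map f zs)) = wd [f a] * (\<Sum>zs\<in>Y. wd (map f zs))" for a Y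
    by (simp add: sum.reindex sum_distrib_left wd_mult)
  moreover have "(#) x ` shuffles xs (y # ys) \<inter> (#) y ` shuffles (x # xs) ys = {}"
    using 3(3) by auto
  ultimately show ?case using 3 by (simp add: sum.union_disjoint)
qed simp_all

lemma shuffle_sum:
  "shuffle (sum g A) (sum h B) = (\<Sum>x\<in>A. \<Sum>y\<in>B. shuffle (g x) (h y))"
proof -
  have "shuffle p (sum h B) = (\<Sum>y\<in>B. shuffle p (h y))" for p
    by (induction B rule: infinite_finite_induct) simp_all
  then show ?thesis
    by (induction A rule: infinite_finite_induct) (simp_all add: sum.distrib)
qed

text \<open>A linear extension of a disjoint union is an interleaving of linear extensions of the
  parts. Restriction to \<open>A\<close> and to \<open>B\<close> recovers these, so different pairs
  have disjoint sets of interleavings.\<close>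

lemma lin_ext_sum_disjoint_union:
  assumes fin: "finite A" "finite B" and disj: "A \<inter> B = {}" and r: "r \<subseteq> A \<times> A" "r' \<subseteq> B \<times> B"
  shows "lin_ext_sum (A \<union> B) (r \<union> r') f = shuffle (lin_ext_sum A r f) (lin_ext_sum B r' f)"
proof -
  let ?I = "lin_exts A r \<times> lin_exts B r'"
  have filt: "filter (\<lambda>x. x \<in> A) zs = us" "filter (\<lambda>x. x \<in> B) zs = vs"
    if "us \<in> lin_exts A r" "vs \<in> lin_exts B r'" "zs \<in> shuffles us vs" for us vs zs
  proof -
    have *: "set us = A" "set vs = B" using that by (auto simp: lin_exts_def)
    then have d: "set us \<inter> set vs = {}" using disj by simp
    show "filter (\<lambda>x. x \<in> A) zs = us"
      using filter_shuffles_disjoint1(1)[OF d that(3)] * by simp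
    show "filter (\<lambda>x. x \<in> B) zs = vs"
      using filter_shuffles_disjoint2(1)[OF d that(3)] * by simp
  qed
  have eq: "lin_exts (A \<union> B) (r \<union> r') = (\<Union>p\<in>?I. shuffles (fst p) (snd p))"
  proof (intro equalityI subsetI)
    fix zs assume zs: "zs \<in> lin_exts (A \<union> B) (r \<union> r')"
    let ?us = "filter (\<lambda>x. x \<in> A) zs" and ?vs = "filter (\<lambda>x. x \<notin> A) zs"
    have "zs \<in> shuffles ?us ?vs" by (rule partition_in_shuffles)
    moreover have "sorted_wrt (\<lambda>x y. (y, x) \<notin> r) zs" "sorted_wrt (\<lambda>x y. (y, x) \<notin> r') zs"
      using zs by (auto simp: lin_exts_def elim!: sorted_wrt_mono_rel[rotated])
    then have "(?us, ?vs) \<in> ?I"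
      using zs disj by (auto simp: lin_exts_def sorted_wrt_filter)
    ultimately show "zs \<in> (\<Union>p\<in>?I. shuffles (fst p) (snd p))" by force
  next
    fix zs assume "zs \<in> (\<Union>p\<in>?I. shuffles (fst p) (snd p))"
    then obtain us vs where uv: "us \<in> lin_exts A r" "vs \<in> lin_exts B r'" "zs \<in> shuffles us vs"
      by auto
    have *: "set us = A" "set vs = B" "distinct us" "distinct vs" using uv by (auto simp: lin_exts_def)
    have "sorted_wrt (\<lambda>x y. (y, x) \<notin> r) zs"
      by (rule sorted_wrt_filterI[OF r(1)]) (use filt[OF uv] uv(1) in \<open>simp add: lin_exts_def\<close>)
    moreover have "sorted_wrt (\<lambda>x y. (y, x) \<notin> r') zs"
      by (rule sorted_wrt_filterI[OF r(2)]) (use filt[OF uv] uv(2) in \<open>simp add: lin_exts_def\<close>)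
    ultimately have "sorted_wrt (\<lambda>x y. (y, x) \<notin> r \<union> r') zs"
      unfolding sorted_wrt_iff_nth_less by auto
    moreover have "set zs = A \<union> B" using set_shuffles[OF uv(3)] * by simp
    moreover have "distinct zs" using distinct_disjoint_shuffles[OF *(3,4) _ uv(3)] * disj by simp
    ultimately show "zs \<in> lin_exts (A \<union> B) (r \<union> r')" by (simp add: lin_exts_def)
  qed
  have dis: "shuffles (fst p) (snd p) \<inter> shuffles (fst q) (snd q) = {}"
    if "p \<in> ?I" "q \<in> ?I" "p \<noteq> q" for p q
  proof (rule ccontr)
    assume "shuffles (fst p) (snd p) \<inter> shuffles (fst q) (snd q) \<noteq> {}"
    then obtain zs where "zs \<in> shuffles (fst p) (snd p)" "zs \<in> shuffles (fst q) (snd q)" by blast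
    then have "fst p = fst q" "snd p = snd q"
      using filt[of "fst p" "snd p" zs] filt[of "fst q" "snd q" zs] that(1,2)
      by (simp_all add: mem_Times_iff)
    then show False using that(3) by (simp add: prod_eq_iff)
  qed
  have "lin_ext_sum (A \<union> B) (r \<union> r') f =
      (\<Sum>p\<in>?I. \<Sum>zs\<in>shuffles (fst p) (snd p). wd (map f zs))"
    unfolding lin_ext_sum_def eq
  proof (rule sum.UNION_disjoint)
    show "finite ?I" by (intro finite_cartesian_product finite_lin_exts fin)
    show "\<forall>p\<in>?I. finite (shuffles (fst p) (snd p))" by simp
    show "\<forall>p\<in>?I. \<forall>q\<in>?I. p \<noteq> q \<longrightarrow>
        shuffles (fst p) (snd p) \<inter> shuffles (fst q) (snd q) = {}"
      by (intro ballI impI dis)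
  qed
  also have "\<dots> = (\<Sum>p\<in>?I. shuffle (wd (map f (fst p))) (wd (map f (snd p))))"
    using disj by (intro sum.cong) (auto simp: shuffle_wd sum_shuffles lin_exts_def)
  also have "\<dots> = shuffle (lin_ext_sum A r f) (lin_ext_sum B r' f)"
    by (simp add: lin_ext_sum_def shuffle_sum sum.cartesian_product case_prod_unfold)
  finally show ?thesis .
qed

section \<open>Chains with a poset hanging from their last element\<close>

fun chain_rel :: "'a list \<Rightarrow> ('a \<times> 'a) set" where
  "chain_rel (x # y # c) = insert (x, y) (chain_rel (y # c))"
| "chain_rel _ = {}"

lemma chain_rel_subset: "chain_rel c \<subseteq> set c \<times> set c"
  by (induction c rule: chain_rel.induct) auto

lemma chain_rel_append:
  "c \<noteq> [] \<Longrightarrow> d \<noteq> [] \<Longrightarrow> chain_rel (c @ d) = insert (last c, hd d) (chain_rel c \<union> chain_rel d)"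
proof (induction c rule: chain_rel.induct)
  case ("2_2" x)
  then show ?case by (cases d) auto
qed auto

lemma lin_exts_chain: "distinct c \<Longrightarrow> lin_exts (set c) (chain_rel c) = {c}"
proof (induction c rule: chain_rel.induct)
  case (1 x y c)
  have IH: "lin_exts (set (y # c)) (chain_rel (y # c)) = {y # c}" using 1 by simp
  have nin: "(v, u) \<notin> chain_rel (y # c)" if "v = x \<or> u = x" for u v
    using chain_rel_subset[of "y # c"] 1(2) that by auto
  have "zs = x # y # c" if zs: "zs \<in> lin_exts (set (x # y # c)) (chain_rel (x # y # c))" for zs
  proof -
    have "x \<in> set zs" "distinct zs" using zs by (auto simp: lin_exts_def)
    then obtain us vs where uv: "zs = us @ x # vs" by (meson split_list)
    have "us @ vs \<in> lin_exts (set (y # c)) (chain_rel (y # c))"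
    proof -
      have xs: "distinct (us @ x # vs)" "set (us @ x # vs) = insert x (set (y # c))"
        "sorted_wrt (\<lambda>u v. (v, u) \<notin> chain_rel (x # y # c)) (us @ x # vs)"
        using zs unfolding uv lin_exts_def by auto
      have "set (us @ vs) = set (us @ x # vs) - {x}" using xs(1) by auto
      also have "\<dots> = set (y # c)" unfolding xs(2) using 1(2) by auto
      finally have "set (us @ vs) = set (y # c)" .
      moreover have "sorted_wrt (\<lambda>u v. (v, u) \<notin> chain_rel (x # y # c)) (us @ vs)"
        using xs(3) unfolding sorted_wrt_append by simp
      then have "sorted_wrt (\<lambda>u v. (v, u) \<notin> chain_rel (y # c)) (us @ vs)"
        by (rule sorted_wrt_mono_rel[rotated]) simp
      ultimately show ?thesis using xs(1) by (simp add: lin_exts_def)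
    qed
    then have e: "us @ vs = y # c" using IH by simp
    \<comment> \<open>\<open>x\<close> comes before \<open>y\<close>, and \<open>y\<close> is the
      head of what remains, so nothing can precede \<open>x\<close>.\<close>
    have "us = []"
    proof (rule ccontr)
      assume "us \<noteq> []"
      then have "y \<in> set us" using e by (cases us) auto
      then have "(x, y) \<notin> chain_rel (x # y # c)"
        using zs unfolding uv lin_exts_def sorted_wrt_append mem_Collect_eq
        by (meson list.set_intros(1))
      then show False by simp
    qed
    then show ?thesis using uv e by simp
  qed
  moreover have "x # y # c \<in> lin_exts (set (x # y # c)) (chain_rel (x # y # c))"
  proof -
    have "y # c \<in> lin_exts (set (y # c)) (chain_rel (y # c))" using IH by simp
    then have "sorted_wrt (\<lambda>u v. (v, u) \<notin> chain_rel (x # y # c)) (y # c)"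
      unfolding lin_exts_def mem_Collect_eq
      by (elim conjE sorted_wrt_mono_rel[rotated]) (use 1(2) in auto)
    then show ?thesis using 1(2) nin unfolding lin_exts_def by auto
  qed
  ultimately show ?case by blast
next
  case ("2_2" v)
  have "zs = [v]" if "distinct zs" "set zs = {v}" for zs
    using that by (cases zs; cases "tl zs") auto
  then show ?case by (auto simp: lin_exts_def)
qed (auto simp: lin_exts_def)

text \<open>\<open>sh.H\<close> with an arbitrary word as first argument: in
  \<open>lin_ext_sum_hook\<close> the chain may carry any labels, and only the blocks hanging from
  it are labelled like an index.\<close>

primrec H_word :: "letter list \<Rightarrow> nat list \<Rightarrow> ncpoly" where
  "H_word w [] = wd w"
| "H_word w (a # l) = shuffle (wd w) (H_word (E1 # replicate (a - 1) E0) l)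
     - H_word (w @ E1 # replicate (a - 1) E0) l"

lemma H_word_index_word: "H_word (index_word k) l = sh.H k l"
proof (induction l arbitrary: k)
  case (Cons a l)
  show ?case using Cons[of "[a]"] Cons[of "k @ [a]"] by (simp add: ind_eq_wd index_word_def)
qed (simp add: ind_eq_wd)

definition block :: "(nat \<times> nat \<Rightarrow> 'a) \<Rightarrow> nat \<Rightarrow> nat \<Rightarrow> 'a list" where
  "block g j d = map (\<lambda>i. g (j, i)) [1..<Suc d]"

text \<open>The order of the chain \<open>c\<close> together with the copy under \<open>g\<close> of the poset of \<open>l\<close>, whose
  element $b_{s,1}$ is placed below the last element of \<open>c\<close>.\<close>

definition hook_rel :: "(nat \<times> nat \<Rightarrow> 'a) \<Rightarrow> 'a list \<Rightarrow> nat list \<Rightarrow> ('a \<times> 'a) set" where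
  "hook_rel g c l = chain_rel c \<union> map_prod g g ` P_gen l
     \<union> (if l = [] then {} else {(g (length l, 1), last c)})"

lemma block_simps: "1 \<le> d \<Longrightarrow> block g j d \<noteq> []" "1 \<le> d \<Longrightarrow> hd (block g j d) = g (j, 1)"
    "1 \<le> d \<Longrightarrow> last (block g j d) = g (j, d)" "set (block g j d) = g ` {(j, i) |i. 1 \<le> i \<and> i \<le> d}"
    "inj g \<Longrightarrow> distinct (block g j d)"
proof -
  show "1 \<le> d \<Longrightarrow> hd (block g j d) = g (j, 1)"
    by (simp add: block_def upt_conv_Cons del: upt_Suc)
  show "set (block g j d) = g ` {(j, i) |i. 1 \<le> i \<and> i \<le> d}"
    by (auto simp: block_def image_iff)
  show "inj g \<Longrightarrow> distinct (block g j d)"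
    by (auto simp: block_def distinct_map inj_on_def inj_def simp del: upt_Suc)
qed (auto simp: block_def)

lemma chain_rel_upt: "chain_rel (map f [1..<Suc n]) = {(f i, f (i + 1)) |i. 1 \<le> i \<and> i < n}"
proof (induction n)
  case (Suc n)
  show ?case
  proof (cases "n = 0")
    case False
    then have "chain_rel (map f [1..<Suc n] @ [f (Suc n)]) =
        insert (f n, f (Suc n)) (chain_rel (map f [1..<Suc n]))"
      by (subst chain_rel_append) (auto simp: last_map)
    then show ?thesis using Suc False by (auto simp: less_Suc_eq)
  qed simp
qed simp

lemma P_carr_snoc: "P_carr (l @ [d]) = P_carr l \<union> {(Suc (length l), i) |i. 1 \<le> i \<and> i \<le> d}"
proof -
  have "(j, i) \<in> P_carr (l @ [d]) \<longleftrightarrow> (j, i) \<in> P_carr l \<or> j = Suc (length l) \<and> 1 \<le> i \<and> i \<le> d" for j i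
    by (cases "j = Suc (length l)") (auto simp: P_carr_def nth_append)
  then show ?thesis by auto
qed

lemma P_gen_snoc: "P_gen (l @ [d]) = P_gen l
    \<union> {((Suc (length l), i), (Suc (length l), i + 1)) |i. 1 \<le> i \<and> i < d}
    \<union> (if l = [] then {} else {((length l, 1), (Suc (length l), d))})"
proof -
  let ?s = "Suc (length l)"
  have nth: "(l @ [d]) ! (j - 1) = (if j = ?s then d else l ! (j - 1))" if "1 \<le> j" "j \<le> ?s" for j
    using that by (auto simp: nth_append)
  have "p \<in> P_gen (l @ [d]) \<longleftrightarrow> p \<in> P_gen l \<or>
      (\<exists>i. p = ((?s, i), (?s, i + 1)) \<and> 1 \<le> i \<and> i < d) \<or> (l \<noteq> [] \<and> p = ((length l, 1), (?s, d)))"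
    (is "?L \<longleftrightarrow> ?R") for p
  proof
    assume ?L
    then consider j i where "p = ((j, i), (j, i + 1))" "1 \<le> j" "j \<le> ?s" "1 \<le> i" "i < (l @ [d]) ! (j - 1)"
      | j where "p = ((j - 1, 1), (j, (l @ [d]) ! (j - 1)))" "2 \<le> j" "j \<le> ?s"
      by (auto simp: P_gen_def)
    then show ?R
    proof cases
      case 1
      then show ?thesis using nth[of j] by (cases "j = ?s") (auto simp: P_gen_def)
    next
      case 2
      then show ?thesis using nth[of j] by (cases "j = ?s") (auto simp: P_gen_def)
    qed
  next
    assume ?R
    then consider j i where "p = ((j, i), (j, i + 1))" "1 \<le> j" "j \<le> length l" "1 \<le> i" "i < l ! (j - 1)"
      | j where "p = ((j - 1, 1), (j, l ! (j - 1)))" "2 \<le> j" "j \<le> length l"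
      | i where "p = ((?s, i), (?s, i + 1))" "1 \<le> i" "i < d"
      | "l \<noteq> []" "p = ((length l, 1), (?s, d))"
      by (auto simp: P_gen_def)
    then show ?L
    proof cases
      case 1
      then have "i < (l @ [d]) ! (j - 1)" using nth[of j] by simp
      then show ?thesis using 1 by (auto simp: P_gen_def)
    next
      case 2
      then have "(l @ [d]) ! (j - 1) = l ! (j - 1)" using nth[of j] by simp
      then show ?thesis unfolding P_gen_def using 2 
        by (intro UnI2 CollectI exI[of _ j]) auto
    next
      case 3
      then show ?thesis using nth[of ?s] unfolding P_gen_def
        by (intro UnI1 CollectI exI[of _ ?s] exI[of _ i]) auto
    next
      case 4
      then show ?thesis using nth[of ?s] unfolding P_gen_def
        by (intro UnI2 CollectI exI[of _ ?s]) (auto simp: Suc_le_eq)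
    qed
  qed
  then show ?thesis by (auto split: if_splits)
qed

text \<open>The last block is a chain, and the relation \<open>b_{j-1,1} < b_{j,l_j}\<close> hangs
  the poset of the remaining entries from its last element.\<close>

lemma image_P_gen_snoc:
  assumes "1 \<le> d"
  shows "map_prod g g ` P_gen (l @ [d]) = hook_rel g (block g (Suc (length l)) d) l"
proof -
  have "chain_rel (block g (Suc (length l)) d) =
      map_prod g g ` {((Suc (length l), i), (Suc (length l), i + 1)) |i. 1 \<le> i \<and> i < d}"
    unfolding block_def chain_rel_upt by (auto simp: image_iff) 
  then show ?thesis
    unfolding hook_rel_def P_gen_snoc using assms by (auto simp: image_Un block_simps)
qed

lemma hook_rel_append:
  assumes "c \<noteq> []" "b \<noteq> []"
  shows "hook_rel g (c @ b) l = insert (last c, hd b) (chain_rel c \<union> hook_rel g b l)"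
  using assms by (auto simp: hook_rel_def chain_rel_append)

text \<open>Without a relation between \<open>c\<close> and the poset of \<open>l @ [d]\<close>, the
  sum is a shuffle product. Comparing the last element of \<open>c\<close> with the first element of
  the last block splits it into the wanted sum and the one for a longer chain, which is the
  recursion of \<open>H_word\<close>.\<close>

lemma lin_ext_sum_hook:
  assumes "inj g"
  shows "is_index l \<Longrightarrow> c \<noteq> [] \<Longrightarrow> distinct c \<Longrightarrow> set c \<inter> g ` P_carr l = {} \<Longrightarrow>
    (\<And>j i. (j, i) \<in> P_carr l \<Longrightarrow> f (g (j, i)) = (if i = 1 then E1 else E0)) \<Longrightarrow>
    lin_ext_sum (set c \<union> g ` P_carr l) (hook_rel g c l) f = H_word (map f c) (rev l)"
proof (induction l arbitrary: c rule: rev_induct)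
  case Nil
  have "P_carr [] = {}" "P_gen [] = {}" by (auto simp: P_carr_def P_gen_def)
  then show ?case using Nil by (simp add: hook_rel_def lin_ext_sum_def lin_exts_chain)
next
  case (snoc d l)
  let ?s = "Suc (length l)"
  let ?b = "block g ?s d"
  have d: "1 \<le> d" and l: "is_index l" using snoc.prems by auto
  have carr: "g ` P_carr (l @ [d]) = set ?b \<union> g ` P_carr l"
    by (auto simp: P_carr_snoc block_simps)
  have lab: "map f ?b = E1 # replicate (d - 1) E0"
  proof -
    have "map f ?b = map (\<lambda>i. if i = 1 then E1 else E0) [1..<Suc d]"
      using snoc.prems(5) by (auto simp: block_def P_carr_snoc simp del: upt_Suc)
    also have "[1..<Suc d] = 1 # [2..<Suc d]"
      using d by (simp add: upt_conv_Cons numeral_2_eq_2 del: upt_Suc)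
    also have "map (\<lambda>i. if i = 1 then E1 else E0) (1 # [2..<Suc d]) = E1 # map (\<lambda>i. E0) [2..<Suc d]"
      by (auto simp del: upt_Suc)
    finally show ?thesis by (simp add: map_replicate_const del: upt_Suc)
  qed
  have disj: "set ?b \<inter> g ` P_carr l = {}"
    using assms by (auto simp: block_simps P_carr_def dest: injD)
  have disj': "set c \<inter> (set ?b \<union> g ` P_carr l) = {}" using snoc.prems(4) carr by simp
  have flab: "\<And>j i. (j, i) \<in> P_carr l \<Longrightarrow> f (g (j, i)) = (if i = 1 then E1 else E0)"
    using snoc.prems(5) by (auto simp: P_carr_snoc)
  have IH1: "lin_ext_sum (set ?b \<union> g ` P_carr l) (hook_rel g ?b l) f = H_word (map f ?b) (rev l)"
    using l d disj assms flab by (intro snoc.IH) (auto simp: block_simps)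
  have IH2: "lin_ext_sum (set (c @ ?b) \<union> g ` P_carr l) (hook_rel g (c @ ?b) l) f =
      H_word (map f (c @ ?b)) (rev l)"
    using l d disj disj' assms flab snoc.prems(2,3) by (intro snoc.IH) (auto simp: block_simps(5))
  let ?A = "set c \<union> (set ?b \<union> g ` P_carr l)" and ?r = "chain_rel c \<union> hook_rel g ?b l"
  have sub: "hook_rel g ?b l \<subseteq> (set ?b \<union> g ` P_carr l) \<times> (set ?b \<union> g ` P_carr l)"
    using P_gen_carr[OF snoc.prems(1)] unfolding image_P_gen_snoc[OF d, symmetric] carr[symmetric]
    by auto
  have "lin_ext_sum ?A ?r f = shuffle (wd (map f c)) (H_word (map f ?b) (rev l))"
    using lin_ext_sum_disjoint_union[of "set c" "set ?b \<union> g ` P_carr l" "chain_rel c" "hook_rel g ?b l" f]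
      disj' sub chain_rel_subset[of c] IH1 finite_P_carr[of l] lin_exts_chain[OF snoc.prems(3)]
    by (simp add: lin_ext_sum_def)
  moreover have "lin_ext_sum ?A ?r f =
      lin_ext_sum ?A (insert (hd ?b, last c) ?r) f + lin_ext_sum ?A (insert (last c, hd ?b) ?r) f"
  proof (rule lin_ext_sum_split)
    have "last c \<in> set c" "hd ?b \<in> set ?b" using snoc.prems(2) hd_in_set[OF block_simps(1)[OF d]] by auto
    then show "hd ?b \<in> ?A" "last c \<in> ?A" "hd ?b \<noteq> last c" using disj' by auto
  qed (simp add: finite_P_carr)
  \<comment> \<open>If the block lies above \<open>c\<close>, the two join to a single
    chain.\<close>
  moreover have "insert (last c, hd ?b) ?r = hook_rel g (c @ ?b) l"
    using snoc.prems(2) d by (simp add: hook_rel_append block_simps)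
  \<comment> \<open>If the block starts below the last element of \<open>c\<close>, the whole poset
    of \<open>l @ [d]\<close> hangs from \<open>c\<close>.\<close>
  moreover have "insert (hd ?b, last c) ?r = hook_rel g c (l @ [d])"
    unfolding hook_rel_def[of g c "l @ [d]"] image_P_gen_snoc[OF d] using d by (simp add: block_simps)
  ultimately have "lin_ext_sum ?A (hook_rel g c (l @ [d])) f =
      shuffle (wd (map f c)) (H_word (map f ?b) (rev l)) - lin_ext_sum ?A (hook_rel g (c @ ?b) l) f"
    by (simp add: eq_diff_eq)
  moreover have "?A = set (c @ ?b) \<union> g ` P_carr l" by auto
  ultimately have "lin_ext_sum ?A (hook_rel g c (l @ [d])) f =
      shuffle (wd (map f c)) (H_word (map f ?b) (rev l)) - H_word (map f c @ map f ?b) (rev l)"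
    using IH2 by (simp only: map_append)
  then show ?case by (simp add: carr lab)
qed

lemma W_P_eq_S: "is_index l \<Longrightarrow> W (P E1 l) = sh.S (rev l)"
proof (cases l rule: rev_cases)
  case Nil
  have "P_carr [] = {}" by (auto simp: P_carr_def)
  then have "linear_extensions (P E1 []) = {[]}"
    by (auto simp: linear_extensions_def P_def)
  then show ?thesis by (simp add: Nil W_def wd_Nil)
next
  case (snoc l' d)
  assume l: "is_index l"
  let ?b = "block id (Suc (length l')) d"
  have d: "1 \<le> d" "is_index l'" using l snoc by auto
  have gen: "P_gen l = hook_rel id ?b l'"
    using image_P_gen_snoc[OF d(1), of id l'] snoc by (simp add: map_prod.id)
  have carr: "P_carr l = set ?b \<union> id ` P_carr l'"
    unfolding snoc P_carr_snoc by (auto simp: block_simps)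
  have "W (P E1 l) = lin_ext_sum (P_carr l) (P_gen l) (P_lab E1 l)"
    using W_eq_lin_ext_sum[of "P E1 l" "P_gen l"] P_gen_carr[OF l] by (simp add: P_def)
  also have "\<dots> = H_word (map (P_lab E1 l) ?b) (rev l')"
    unfolding gen carr using d
    by (intro lin_ext_sum_hook) (auto simp: block_simps P_carr_def P_lab_def)
  also have "map (P_lab E1 l) ?b = index_word [d]"
  proof -
    have "[1..<Suc d] = 1 # [2..<Suc d]"
      using d by (simp add: upt_conv_Cons numeral_2_eq_2 del: upt_Suc)
    then have "map (P_lab E1 l) ?b = E1 # map (\<lambda>i. E0) [2..<Suc d]"
      by (auto simp: block_def P_lab_def simp del: upt_Suc)
    then show ?thesis by (simp add: index_word_def map_replicate_const del: upt_Suc)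
  qed
  finally show ?thesis by (simp add: H_word_index_word snoc)
qed

lemma map_index_labels:
  "is_index k \<Longrightarrow>
   map (\<lambda>t. if t \<in> {sum_list (take j k) + 1 |j. j < length k} then E1 else E0) [1..<Suc (sum_list k)] =
   index_word k"
proof (induction k rule: rev_induct)
  case (snoc a k)
  let ?f = "\<lambda>k t. if t \<in> {sum_list (take j k) + 1 |j. j < length k} then E1 else E0"
  let ?K = "sum_list k"
  have le: "sum_list (take j k) \<le> ?K" for j
    by (metis append_take_drop_id le_add1 sum_list_append)
  have mem: "t \<in> {sum_list (take j (k @ [a])) + 1 |j. j < length (k @ [a])} \<longleftrightarrow>
      t \<in> {sum_list (take j k) + 1 |j. j < length k} \<or> t = ?K + 1" for t
  proof -
    have "{j. j < length (k @ [a])} = insert (length k) {j. j < length k}" by auto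
    moreover have "(\<lambda>j. sum_list (take j (k @ [a])) + 1) ` {j. j < length k} =
        (\<lambda>j. sum_list (take j k) + 1) ` {j. j < length k}"
      by (intro image_cong) auto
    ultimately show ?thesis unfolding setcompr_eq_image by auto
  qed
  have a: "1 \<le> a" using snoc.prems by simp
  have "[1..<Suc (sum_list (k @ [a]))] = [1..<Suc ?K] @ [Suc ?K..<Suc (?K + a)]"
    using upt_add_eq_append[of 1 "Suc ?K" a] by (simp del: upt_Suc)
  also have "[Suc ?K..<Suc (?K + a)] = Suc ?K # [Suc (Suc ?K)..<Suc (?K + a)]"
    using a by (simp add: upt_conv_Cons del: upt_Suc)
  finally have split: "[1..<Suc (sum_list (k @ [a]))] =
      [1..<Suc ?K] @ Suc ?K # [Suc (Suc ?K)..<Suc (?K + a)]" .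
  have "map (?f (k @ [a])) [1..<Suc ?K] = map (?f k) [1..<Suc ?K]"
    unfolding mem by (intro map_cong) auto
  moreover have "map (?f (k @ [a])) [Suc (Suc ?K)..<Suc (?K + a)] = map (\<lambda>_. E0) [Suc (Suc ?K)..<Suc (?K + a)]"
  proof (rule map_cong)
    fix t assume "t \<in> set [Suc (Suc ?K)..<Suc (?K + a)]"
    then have t: "Suc ?K < t" by (simp del: upt_Suc)
    then have "t \<noteq> sum_list (take j k) + 1" for j using le[of j] by simp
    then show "?f (k @ [a]) t = E0" unfolding mem using t by auto
  qed simp
  moreover have "?f (k @ [a]) (Suc ?K) = E1" unfolding mem by simp
  ultimately have "map (?f (k @ [a])) [1..<Suc (sum_list (k @ [a]))] =
      map (?f k) [1..<Suc ?K] @ E1 # map (\<lambda>_. E0) [Suc (Suc ?K)..<Suc (?K + a)]"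
    unfolding split by (simp only: map_append list.map)
  moreover have "map (?f k) [1..<Suc ?K] = index_word k" using snoc by simp
  ultimately show ?case
    by (simp only:) (simp add: index_word_def map_replicate_const del: upt_Suc)
qed (simp add: index_word_def)

text \<open>The extra relation \<open>a_K < b_{s,1}\<close> joins the chain and the last block,
  whose labels are all 0, to one chain. Its word is that of \<open>k @ [c]\<close> followed by
  \<open>d\<close> zeros, hence that of \<open>k @ [c + d]\<close>, and the poset of
  \<open>l\<close> hangs from it.\<close>

lemma mu_eq_H:
  assumes "is_index k" "1 \<le> c" "1 \<le> d" "is_index l"
  shows "mu (k @ [c]) (l @ [d]) = sh.H (k @ [c + d]) (rev l)"
proof -
  let ?k = "k @ [c]" and ?l = "l @ [d]"
  let ?K = "sum_list ?k"
  let ?a = "map Inl [1..<Suc ?K] :: (nat + nat \<times> nat) list"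
  let ?b = "block (Inr :: _ \<Rightarrow> nat + nat \<times> nat) (Suc (length l)) d"
  have K: "1 \<le> ?K" using assms by simp
  have ne: "?a \<noteq> []" "?b \<noteq> []" using K assms(3) by (auto simp: block_simps)
  have "{(Inr x, Inr y) |x y. (x, y) \<in> P_gen ?l} = map_prod Inr Inr ` P_gen ?l"
    by (auto simp: image_iff)
  then have e: "{(Inr x, Inr y) |x y. (x, y) \<in> P_gen ?l} = hook_rel Inr ?b l"
    using image_P_gen_snoc[OF assms(3)] by metis
  have last: "last ?a = Inl ?K" using K by (simp add: last_map)
  have hd: "hd ?b = Inr (length ?l, 1)" using assms(3) by (simp add: block_simps)
  have gen: "Q_gen ?k ?l = hook_rel Inr (?a @ ?b) l"
    unfolding Q_gen_def hook_rel_append[OF ne] e last hd chain_rel_upt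
    by (simp only: Un_insert_right Un_empty_right)
  have carr: "Q_carr ?k ?l = set (?a @ ?b) \<union> Inr ` P_carr l"
    unfolding Q_carr_def P_carr_snoc by (auto simp: block_simps simp del: upt_Suc)
  have "Q_gen ?k ?l \<subseteq> Q_carr ?k ?l \<times> Q_carr ?k ?l"
  proof -
    have "(length ?l, 1) \<in> P_carr ?l" using assms(3) by (simp add: P_carr_def)
    moreover have "P_gen ?l \<subseteq> P_carr ?l \<times> P_carr ?l" using assms by (intro P_gen_carr) auto
    ultimately show ?thesis using K unfolding Q_gen_def Q_carr_def by auto
  qed
  then have "mu ?k ?l = lin_ext_sum (Q_carr ?k ?l) (Q_gen ?k ?l) (Q_lab ?k ?l)"
    using W_eq_lin_ext_sum[of "Q ?k ?l" "Q_gen ?k ?l"] by (simp add: mu_def Q_def)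
  also have "\<dots> = H_word (map (Q_lab ?k ?l) (?a @ ?b)) (rev l)"
    unfolding gen carr
  proof (rule lin_ext_sum_hook)
    show "distinct (?a @ ?b)"
      by (auto simp: distinct_map block_simps simp del: upt_Suc)
    show "set (?a @ ?b) \<inter> Inr ` P_carr l = {}"
      by (auto simp: block_simps P_carr_def simp del: upt_Suc)
  qed (use assms ne in \<open>auto simp: Q_lab_def P_lab_def P_carr_def\<close>)
  also have "map (Q_lab ?k ?l) (?a @ ?b) = index_word ?k @ replicate d E0"
  proof -
    have "map (Q_lab ?k ?l) ?a = index_word ?k"
      using map_index_labels[of ?k] assms by (simp add: Q_lab_def comp_def del: upt_Suc)
    moreover have "map (Q_lab ?k ?l) ?b = map (\<lambda>_. E0) [1..<Suc d]"
      by (auto simp: Q_lab_def P_lab_def block_def simp del: upt_Suc)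
    ultimately show ?thesis by (simp add: map_replicate_const del: upt_Suc)
  qed
  also have "\<dots> = index_word (k @ [c + d])"
    using assms(2) by (simp add: index_word_def flip: replicate_add)
  finally show ?thesis by (simp add: H_word_index_word)
qed

section \<open>Comparing two regularizations\<close>

lemma higher_pderiv_exp_Tu:
  "(pderiv ^^ i) (monom (1 / fact n) n) = (if i \<le> n then monom (1 / fact (n - i)) (n - i) else 0 :: real poly)"
proof (induction i)
  case (Suc i)
  have "pderiv (monom (1 / fact m) m) = (if 0 < m then monom (1 / fact (m - 1)) (m - 1) else 0 :: real poly)"
    for m by (cases m) (auto simp: pderiv_monom simp del: of_nat_Suc)
  then show ?case using Suc by simp
qed simp

lemma higher_pderiv_eq_0: "degree (p :: real poly) < i \<Longrightarrow> (pderiv ^^ i) p = 0"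
  by (rule poly_eqI) (simp add: coeff_higher_pderiv coeff_eq_0)

text \<open>\<open>D\<close> multiplies the exponential \<open>exp_Tu\<close> by u, so A(D)
  satisfies the defining equation of \<open>rho_of A\<close>. The free bound \<open>N\<close> allows
  all terms of an alternating sum to share one range.\<close>

lemma rho_of_eq_sum:
  assumes "degree p \<le> N"
  shows "rho_of A p = (\<Sum>i\<le>N. smult (fps_nth A i) ((pderiv ^^ i) p))"
proof -
  define r where "r p = (\<Sum>i\<le>degree p. smult (fps_nth A i) ((pderiv ^^ i) p))" for p
  have r_eq: "r p = (\<Sum>i\<le>N. smult (fps_nth A i) ((pderiv ^^ i) p))" if "degree p \<le> N" for p N
    unfolding r_def using that
    by (intro sum.mono_neutral_left) (auto simp: higher_pderiv_eq_0)
  have "is_rho A r"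
    unfolding is_rho_def
  proof (intro conjI allI)
    show "r (p + q) = r p + r q" for p q
      by (simp add: r_eq[of _ "max (degree p) (degree q)"] degree_add_le sum.distrib
          smult_add_right higher_pderiv_add)
    show "r (smult c p) = smult c (r p)" for c p
    proof -
      have "r (smult c p) = (\<Sum>i\<le>degree p. smult c (smult (fps_nth A i) ((pderiv ^^ i) p)))"
        by (simp add: r_eq[of _ "degree p"] higher_pderiv_smult mult.commute)
      also have "\<dots> = smult c (r p)"
        unfolding r_def using sum_distrib_left[of "[:c:]" _ "{..degree p}"] by simp
      finally show ?thesis .
    qed
    show "Abs_fps (\<lambda>n. r (fps_nth exp_Tu n)) = Abs_fps (\<lambda>n. [:fps_nth A n:]) * exp_Tu"
    proof (rule fps_ext)
      fix n
      have "r (fps_nth exp_Tu n) = (\<Sum>i\<le>n. smult (fps_nth A i) (monom (1 / fact (n - i)) (n - i)))"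
        by (simp add: exp_Tu_def r_eq[of _ n] degree_monom_le higher_pderiv_exp_Tu)
      then show "fps_nth (Abs_fps (\<lambda>n. r (fps_nth exp_Tu n))) n =
          fps_nth (Abs_fps (\<lambda>n. [:fps_nth A n:]) * exp_Tu) n"
        by (simp add: fps_mult_nth exp_Tu_def atLeast0AtMost)
    qed
  qed
  then have "rho_of A = r" using is_rho_rho_of ex1_is_rho by blast
  then show ?thesis using r_eq assms by simp
qed

lemma rho_of_0 [simp]: "rho_of A 0 = 0"
  by (simp add: rho_of_eq_sum[of 0 0])

lemma rho_of_const: "pderiv p = 0 \<Longrightarrow> rho_of A p = smult (fps_nth A 0) p"
proof -
  assume "pderiv p = 0"
  then have "degree p \<le> 0" by (simp add: pderiv_eq_0_iff)
  from rho_of_eq_sum[OF this] show ?thesis by simp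
qed

text \<open>The sum over the cuts of \<open>l\<close> with terms
  \<open>(-1) ^ i * n (k @ take i l) * s (drop i l)\<close>; it is what a regularization makes of
  \<open>H\<close>, see \<open>F_H\<close>.\<close>

primrec tele :: "(nat list \<Rightarrow> 'a::comm_ring_1) \<Rightarrow> (nat list \<Rightarrow> 'a) \<Rightarrow> nat list \<Rightarrow> nat list \<Rightarrow> 'a" where
  "tele n s k [] = n k * s []"
| "tele n s k (a # l) = n k * s (a # l) - tele n s (k @ [a]) l"

lemma tele_cong:
  "(\<And>i. i \<le> length l \<Longrightarrow> n (k @ take i l) = n' (k @ take i l)) \<Longrightarrow>
   (\<And>i. i \<le> length l \<Longrightarrow> s (drop i l) = s' (drop i l)) \<Longrightarrow> tele n s k l = tele n' s' k l"
proof (induction l arbitrary: k)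
  case Nil
  then show ?case using Nil.prems(1)[of 0] Nil.prems(2)[of 0] by simp
next
  case (Cons a l)
  have "tele n s (k @ [a]) l = tele n' s' (k @ [a]) l"
    by (rule Cons.IH) (use Cons.prems(1)[of "Suc _"] Cons.prems(2)[of "Suc _"] in auto)
  then show ?case using Cons.prems(1)[of 0] Cons.prems(2)[of 0] by simp
qed

text \<open>\<open>n (k @ l)\<close> stands only in the term of the last cut, up to sign with factor
  \<open>s [] = 1\<close>.\<close>

lemma tele_last_eq:
  "(\<And>i. i < length l \<Longrightarrow> n (k @ take i l) = n' (k @ take i l)) \<Longrightarrow>
   tele n s k l = tele n' s k l \<Longrightarrow> s [] = 1 \<Longrightarrow> n (k @ l) = n' (k @ l)"
proof (induction l arbitrary: k)
  case (Cons a l)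
  have "n ((k @ [a]) @ l) = n' ((k @ [a]) @ l)"
    by (rule Cons.IH) (use Cons.prems(1)[of "Suc _"] Cons.prems(1)[of 0] Cons.prems(2,3) in auto)
  then show ?case by simp
qed simp

lemma tele_sum_left: "tele (\<lambda>k. \<Sum>i\<in>I. n i k) s k l = (\<Sum>i\<in>I. tele (n i) s k l)"
  by (induction l arbitrary: k) (simp_all add: sum_distrib_right sum_subtractf)

lemma tele_sum_right: "tele n (\<lambda>l. \<Sum>i\<in>I. s i l) k l = (\<Sum>i\<in>I. tele n (s i) k l)"
  by (induction l arbitrary: k) (simp_all add: sum_distrib_left sum_subtractf)

lemma tele_smult:
  "tele (\<lambda>k. smult c (n k)) s k l = smult c (tele n s k l)"
  "tele n (\<lambda>l. smult c (s l)) k l = smult c (tele n s k l)"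
  by (induction l arbitrary: k) (simp_all add: smult_diff_right)

text \<open>\<open>n\<close> and \<open>s\<close> model the regularized values of indices and of
  star elements. The argument of \<open>s\<close> is reversed, so that both derivatives act at the
  cut.\<close>

locale tele_pair =
  fixes n s :: "nat list \<Rightarrow> real poly"
  assumes n_Nil: "n [] = 1" and s_Nil: "s [] = 1"
    and pderiv_n: "is_index k \<Longrightarrow> 1 \<le> a \<Longrightarrow> pderiv (n (k @ [a])) = (if a = 1 then n k else 0)"
    and pderiv_s: "is_index l \<Longrightarrow> 1 \<le> a \<Longrightarrow> pderiv (s (a # l)) = (if a = 1 then s l else 0)"
    and tele_Nil: "tele n s [] (a # l) = 0"
begin

lemma degree_n: "is_index k \<Longrightarrow> degree (n k) \<le> length k"
proof (induction k rule: rev_induct)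
  case (snoc a k)
  then have "degree (pderiv (n (k @ [a]))) \<le> length k" by (auto simp: pderiv_n)
  then show ?case by (simp add: degree_pderiv)
qed (simp add: n_Nil)

lemma degree_s: "is_index l \<Longrightarrow> degree (s l) \<le> length l"
proof (induction l)
  case (Cons a l)
  then have "degree (pderiv (s (a # l))) \<le> length l" by (auto simp: pderiv_s)
  then show ?case by (simp add: degree_pderiv)
qed (simp add: s_Nil)

abbreviation "y i q \<equiv> tele (\<lambda>k. (pderiv ^^ i) (n k)) (\<lambda>l. (pderiv ^^ q) (s l))"

text \<open>At a cut, one derivative of \<open>s (a # l)\<close> and one of
  \<open>n (k @ [a])\<close> both remove \<open>a\<close> if it is 1 and give 0 otherwise. Hence
  neighbouring terms cancel, and only a boundary term at the first cut remains.\<close>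

lemma y_step:
  "is_index k \<Longrightarrow> is_index l \<Longrightarrow>
   y (Suc i) q k l + y i (Suc q) k l = (pderiv ^^ Suc i) (n k) * (pderiv ^^ q) (s l)"
proof (induction l arbitrary: k)
  case Nil
  then show ?case by (simp add: s_Nil funpow_swap1)
next
  case (Cons a l)
  have "(pderiv ^^ i) (n k) * (pderiv ^^ Suc q) (s (a # l)) =
      (pderiv ^^ Suc i) (n (k @ [a])) * (pderiv ^^ q) (s l)"
    using Cons.prems by (simp add: funpow_Suc_right pderiv_n pderiv_s del: funpow.simps)
  also have "\<dots> = y (Suc i) q (k @ [a]) l + y i (Suc q) (k @ [a]) l"
    using Cons.prems by (intro Cons.IH[symmetric]) auto
  finally show ?case by (simp add: algebra_simps)
qed

lemma y_alternating:
  assumes "pderiv (n k) = 0" "is_index k" "is_index l"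
  shows "y i q k l = (-1) ^ i * y 0 (i + q) k l"
proof (induction i arbitrary: q)
  case (Suc i)
  have "y (Suc i) q k l + y i (Suc q) k l = 0"
    unfolding y_step[OF assms(2,3)] using assms(1)
    by (simp add: funpow_Suc_right del: funpow.simps)
  then have "y (Suc i) q k l = - y i (Suc q) k l" by (simp add: eq_neg_iff_add_eq_0)
  then show ?case by (simp add: Suc del: funpow.simps)
qed simp

lemma y_0_eq_0:
  assumes "is_index l" "length l < q"
  shows "y 0 q k l = 0"
proof -
  have "y 0 q k l = tele n (\<lambda>_. 0) k l"
  proof (rule tele_cong)
    fix i
    have "is_index (drop i l)" using assms(1) by (auto simp: is_index_def dest: in_set_dropD)
    then have "degree (s (drop i l)) < q" using degree_s[of "drop i l"] assms(2) by simp
    then show "(pderiv ^^ q) (s (drop i l)) = 0" by (rule higher_pderiv_eq_0)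
  qed simp
  also have "\<dots> = 0" by (induction l arbitrary: k) simp_all
  finally show ?thesis .
qed

lemma tele_rho:
  assumes k: "pderiv (n k) = 0" "is_index k" and l: "is_index l"
    and ab: "(a oo (- fps_X)) * b = (1 :: real fps)"
  shows "tele (\<lambda>k. rho_of a (n k)) (\<lambda>l. rho_of b (s l)) k l = tele n s k l"
proof -
  \<comment> \<open>This bounds the degrees of all factors at all cuts.\<close>
  define N where "N = length k + length l"
  let ?c = "\<lambda>i q. fps_nth a i * (-1) ^ i * fps_nth b q"
  have "tele (\<lambda>k. rho_of a (n k)) (\<lambda>l. rho_of b (s l)) k l =
      tele (\<lambda>k. \<Sum>i\<le>N. smult (fps_nth a i) ((pderiv ^^ i) (n k)))
        (\<lambda>l. \<Sum>q\<le>N. smult (fps_nth b q) ((pderiv ^^ q) (s l))) k l"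
  proof (rule tele_cong; rule rho_of_eq_sum)
    fix i assume i: "i \<le> length l"
    have "is_index (k @ take i l)" "is_index (drop i l)"
      using k(2) l by (auto simp: is_index_def dest: in_set_dropD in_set_takeD)
    from degree_n[OF this(1)] degree_s[OF this(2)] i
    show "degree (n (k @ take i l)) \<le> N" "degree (s (drop i l)) \<le> N"
      by (auto simp: N_def)
  qed
  also have "\<dots> = (\<Sum>i\<le>N. \<Sum>q\<le>N. smult (fps_nth a i) (smult (fps_nth b q) (y i q k l)))"
    by (simp add: tele_sum_left tele_sum_right tele_smult)
  also have "\<dots> = (\<Sum>i\<le>N. \<Sum>q\<le>N. smult (?c i q) (y 0 (i + q) k l))"
  proof (intro sum.cong refl)
    fix i q
    have sg: "(-1) ^ i * p = smult ((-1) ^ i) p" for p :: "real poly"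
      by (cases "even i") simp_all
    show "smult (fps_nth a i) (smult (fps_nth b q) (y i q k l)) = smult (?c i q) (y 0 (i + q) k l)"
      unfolding y_alternating[OF k l, of i q] sg smult_smult by (simp only: mult_ac)
  qed
  also have "\<dots> = (\<Sum>(i, q)\<in>{..N} \<times> {..N}. smult (?c i q) (y 0 (i + q) k l))"
    by (simp add: sum.cartesian_product)
  \<comment> \<open>Outside the triangle \<open>i + q\<close> exceeds \<open>length l\<close>, which
    bounds the degree of every star factor.\<close>
  also have "\<dots> = (\<Sum>(i, q)\<in>{(i, q). i + q \<le> N}. smult (?c i q) (y 0 (i + q) k l))"
  proof (rule sum.mono_neutral_right)
    show "\<forall>p\<in>{..N} \<times> {..N} - {(i, q). i + q \<le> N}. (case p of (i, q) \<Rightarrow> smult (?c i q) (y 0 (i + q) k l)) = 0"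
    proof -
      have "y 0 (i + q) k l = 0" if "\<not> i + q \<le> N" for i q
        using that by (intro y_0_eq_0[OF l]) (simp add: N_def)
      then show ?thesis by (auto, blast)
    qed
  qed auto
  also have "\<dots> = (\<Sum>p\<le>N. \<Sum>i\<le>p. smult (?c i (p - i)) (y 0 p k l))"
    unfolding sum.triangle_reindex_eq by (intro sum.cong refl) simp
  also have "\<dots> = (\<Sum>p\<le>N. smult (\<Sum>i\<le>p. ?c i (p - i)) (y 0 p k l))"
    by (simp add: smult_sum)
  \<comment> \<open>The inner sum is the coefficient of u^p in A(-u) B(u) = 1, with A and B the
    series \<open>a\<close> and \<open>b\<close>.\<close>
  also have "\<dots> = (\<Sum>p\<le>N. if p = 0 then y 0 0 k l else 0)"
  proof (intro sum.cong refl)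
    fix p
    have "(\<Sum>i\<le>p. ?c i (p - i)) = fps_nth ((a oo (- fps_X)) * b) p"
      by (simp add: fps_mult_nth fps_compose_uminus' atLeast0AtMost mult.commute[of "(- 1 :: real) ^ _"])
    then show "smult (\<Sum>i\<le>p. ?c i (p - i)) (y 0 p k l) = (if p = 0 then y 0 0 k l else 0)"
      unfolding ab by simp
  qed
  also have "\<dots> = tele n s k l" by simp
  finally show ?thesis .
qed

end

text \<open>The unprimed pair will come from the harmonic product, the primed one from the shuffle
  product. Before any of the three properties is assumed, \<open>ones\<close> is the only link
  between them.\<close>

locale tele_comparison = T: tele_pair n s + T': tele_pair n' s'
  for n s n' s' :: "nat list \<Rightarrow> real poly" +
  fixes a b :: "real fps"
  assumes ab: "(a oo (- fps_X)) * b = 1" and a_0: "fps_nth a 0 = 1"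
    and ones: "n' (replicate m 1) = rho_of a (n (replicate m 1))"
begin

lemma b_0: "fps_nth b 0 = 1"
proof -
  have "fps_nth ((a oo (- fps_X)) * b) 0 = 1" unfolding ab by simp
  then show ?thesis by (simp add: a_0)
qed

text \<open>For empty \<open>k\<close> and nonempty \<open>l\<close> the alternating sums vanish for
  both pairs. Their first term contains \<open>s' l\<close> and all others shorter star values, so
  induction on the length isolates it. The predicate \<open>R\<close> lets the argument run over all
  indices or over \<open>(1,...,1)\<close> alone.\<close>

lemma star_from_nonstar:
  assumes R: "\<And>x. R x \<Longrightarrow> 1 \<le> x" and n': "\<And>k. list_all R k \<Longrightarrow> n' k = rho_of a (n k)"
  shows "list_all R l \<Longrightarrow> s' l = rho_of b (s l)"
proof (induction "length l" arbitrary: l rule: less_induct)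
  case less
  show ?case
  proof (cases l)
    case Nil
    have "rho_of b 1 = 1" using rho_of_const[of 1 b] by (simp add: b_0)
    then show ?thesis using Nil by (simp add: T.s_Nil T'.s_Nil)
  next
    case (Cons x l')
    have idx: "is_index l" using less.prems R by (auto simp: is_index_def list_all_iff)
    let ?t = "\<lambda>l. rho_of b (s l)"
    have "tele n' ?t [] l = tele (\<lambda>k. rho_of a (n k)) ?t [] l"
      using less.prems n' by (intro tele_cong) (auto simp: list_all_iff dest: in_set_takeD)
    also have "\<dots> = tele n s [] l"
      using idx ab by (intro T.tele_rho) (auto simp: T.n_Nil)
    finally have "tele n' ?t [] l = tele n' s' [] l"
      using T.tele_Nil T'.tele_Nil Cons by simp
    moreover have "tele n' ?t [x] l' = tele n' s' [x] l'"
    proof (rule tele_cong)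
      fix i
      show "?t (drop i l') = s' (drop i l')"
        using less.prems Cons by (intro less.hyps[symmetric]) (auto simp: list_all_iff dest: in_set_dropD)
    qed simp
    ultimately show ?thesis using Cons by (simp add: T'.n_Nil)
  qed
qed

text \<open>The sum is now read from its other end, where \<open>n' (k @ l)\<close> occurs in the
  last term only. Empty \<open>k\<close> leads from (Reg-star) to (Reg); \<open>k\<close> ending in
  an entry of at least 2, with \<open>l\<close> consisting of ones, leads from (Int-Ser) to
  (Reg).\<close>

lemma nonstar_from_star:
  assumes R: "\<And>x. R x \<Longrightarrow> 1 \<le> x" and s': "\<And>l. list_all R l \<Longrightarrow> s' l = rho_of b (s l)"
    and k: "is_index k" "pderiv (n k) = 0"
    and tele: "\<And>l. list_all R l \<Longrightarrow> tele n' s' k l = tele n s k l"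
  shows "list_all R l \<Longrightarrow> n' (k @ l) = rho_of a (n (k @ l))"
proof (induction "length l" arbitrary: l rule: less_induct)
  case less
  show ?case
  proof (rule tele_last_eq)
    fix i assume "i < length l"
    then show "n' (k @ take i l) = rho_of a (n (k @ take i l))"
      using less.prems by (intro less.hyps) (auto simp: list_all_iff dest: in_set_takeD)
  next
    have idx: "is_index l" using less.prems R by (auto simp: is_index_def list_all_iff)
    have "tele n' s' k l = tele (\<lambda>k. rho_of a (n k)) (\<lambda>l. rho_of b (s l)) k l"
      using tele[OF less.prems] T.tele_rho[OF k(2,1) idx ab] by simp
    also have "\<dots> = tele (\<lambda>k. rho_of a (n k)) s' k l"
    proof (rule tele_cong)
      fix i
      show "rho_of b (s (drop i l)) = s' (drop i l)"
        using less.prems by (intro s'[symmetric]) (auto simp: list_all_iff dest: in_set_dropD)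
    qed simp
    finally show "tele n' s' k l = tele (\<lambda>k. rho_of a (n k)) s' k l" .
  qed (rule T'.s_Nil)
qed

text \<open>The three properties of the theorem in terms of the two pairs; \<open>tele_agree\<close>
  is (Int-Ser) by way of \<open>Int_Ser_iff\<close> and \<open>F_H\<close>.\<close>

definition "reg_nonstar \<longleftrightarrow> (\<forall>k. is_index k \<longrightarrow> n' k = rho_of a (n k))"
definition "reg_star \<longleftrightarrow> (\<forall>l. is_index l \<longrightarrow> s' l = rho_of b (s l))"
definition "tele_agree \<longleftrightarrow> (\<forall>k e l. is_index k \<and> 2 \<le> e \<and> is_index l \<longrightarrow>
  tele n' s' (k @ [e]) l = tele n s (k @ [e]) l)"

lemma is_index_list_all: "is_index = list_all (\<lambda>x. 1 \<le> x)"
  by (simp add: fun_eq_iff is_index_def list_all_iff)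

lemma reg_nonstar_iff_reg_star: "reg_nonstar \<longleftrightarrow> reg_star"
proof
  assume "reg_nonstar"
  then show reg_star
    unfolding reg_nonstar_def reg_star_def is_index_list_all using star_from_nonstar[of "\<lambda>x. 1 \<le> x"] by blast
next
  assume s: reg_star
  have "tele n' s' [] l = tele n s [] l" for l
  proof (cases l)
    case Nil
    then show ?thesis by (simp add: T.n_Nil T'.n_Nil T.s_Nil T'.s_Nil)
  next
    case (Cons x l')
    then show ?thesis by (simp only: T.tele_Nil T'.tele_Nil)
  qed
  then have "n' ([] @ l) = rho_of a (n ([] @ l))" if "list_all (\<lambda>x. 1 \<le> x) l" for l
    using s that unfolding reg_star_def is_index_list_all
    by (intro nonstar_from_star[of "\<lambda>x. 1 \<le> x"]) (auto simp: T.n_Nil)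
  then show reg_nonstar unfolding reg_nonstar_def is_index_list_all by simp
qed

lemma reg_nonstar_imp_tele_agree:
  assumes reg_nonstar
  shows tele_agree
  unfolding tele_agree_def
proof (intro allI impI, elim conjE)
  fix k e l assume kel: "is_index k" "(2::nat) \<le> e" "is_index l"
  have "reg_star" using assms reg_nonstar_iff_reg_star by simp
  have "tele n' s' (k @ [e]) l = tele (\<lambda>k. rho_of a (n k)) (\<lambda>l. rho_of b (s l)) (k @ [e]) l"
  proof (rule tele_cong)
    fix i
    have "is_index ((k @ [e]) @ take i l)" "is_index (drop i l)"
      using kel by (auto simp: is_index_def dest: in_set_dropD in_set_takeD)
    then show "n' ((k @ [e]) @ take i l) = rho_of a (n ((k @ [e]) @ take i l))"
      "s' (drop i l) = rho_of b (s (drop i l))"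
      using assms \<open>reg_star\<close> unfolding reg_nonstar_def reg_star_def by blast+
  qed
  also have "\<dots> = tele n s (k @ [e]) l"
    using kel ab by (intro T.tele_rho) (auto simp: T.pderiv_n)
  finally show "tele n' s' (k @ [e]) l = tele n s (k @ [e]) l" .
qed

lemma index_trailing_ones:
  "is_index j \<Longrightarrow> \<exists>k m. j = k @ replicate m 1 \<and> (k = [] \<or> (\<exists>k' e. k = k' @ [e] \<and> 2 \<le> e))"
proof (induction j rule: rev_induct)
  case (snoc x j)
  show ?case
  proof (cases "x = 1")
    case True
    obtain k m where "j = k @ replicate m 1" "k = [] \<or> (\<exists>k' e. k = k' @ [e] \<and> 2 \<le> e)"
      using snoc by auto
    then have "j @ [x] = k @ replicate (Suc m) 1" "k = [] \<or> (\<exists>k' e. k = k' @ [e] \<and> 2 \<le> e)"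
      using True by (simp_all add: replicate_append_same)
    then show ?thesis by blast
  next
    case False
    then have "2 \<le> x" using snoc.prems by simp
    then show ?thesis by (intro exI[of _ "j @ [x]"] exI[of _ 0]) auto
  qed
qed simp

lemma tele_agree_imp_reg_nonstar:
  assumes tele_agree
  shows reg_nonstar
  unfolding reg_nonstar_def
proof (intro allI impI)
  have ones_iff: "list_all (\<lambda>x. x = 1) l \<longleftrightarrow> l = replicate (length l) (1 :: nat)" for l
    by (auto simp: list_all_iff intro: replicate_eqI) (metis in_set_replicate)
  fix j assume j: "is_index j"
  then obtain k m where km: "j = k @ replicate m 1" "k = [] \<or> (\<exists>k' e. k = k' @ [e] \<and> 2 \<le> e)"
    using index_trailing_ones by blast
  show "n' j = rho_of a (n j)"
  proof (cases "k = []")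
    case True
    then show ?thesis using km ones by simp
  next
    case False
    then obtain k' e where k: "k = k' @ [e]" "2 \<le> e" "is_index k'" using km j by auto
    \<comment> \<open>\<open>ones\<close> settles the nonstar values at (1,...,1), and the vanishing
      sums carry this over to their star values.\<close>
    have star: "s' l = rho_of b (s l)" if "list_all (\<lambda>x. x = 1) l" for l
      using that ones ones_iff by (intro star_from_nonstar[of "\<lambda>x. x = 1"]) (auto, metis)
    show ?thesis
      unfolding km(1)
    proof (rule nonstar_from_star[of "\<lambda>x. x = 1", OF _ star])
      show "is_index k" "pderiv (n k) = 0" using k by (auto simp: T.pderiv_n)
      fix l :: "nat list" assume "list_all (\<lambda>x. x = 1) l"
      then have "is_index l" by (auto simp: is_index_def list_all_iff)
      then show "tele n' s' k l = tele n s k l" using assms k unfolding tele_agree_def by blast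
    qed (auto simp: list_all_iff)
  qed
qed

end

section \<open>The equivalence\<close>

context regularizable_character
begin

lemma F_diff: "p \<in> H1 \<Longrightarrow> q \<in> H1 \<Longrightarrow> F (p - q) = F p - F q"
  using F_add[of "p - q" q] by (simp add: algebra_simps)

lemma F_H: "F (H k l) = tele (\<lambda>k. F (ind k)) (\<lambda>l. F (S l)) k l"
proof (induction l arbitrary: k)
  case Nil
  show ?case using F_H0[of 1] by (simp add: Z_one)
next
  case (Cons a l)
  then show ?case by (simp add: F_diff F_mult)
qed

lemma tele_pair_F: "tele_pair (\<lambda>k. F (ind k)) (\<lambda>l. F (S l))"
proof
  have "F 1 = 1" using F_H0[of 1] by (simp add: Z_one)
  then show "F (ind []) = 1" "F (S []) = 1" by (simp_all add: ind_Nil)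
  have "F 0 = 0" using F_H0[of 0] by (simp add: Z_zero)
  then show "is_index k \<Longrightarrow> 1 \<le> a \<Longrightarrow> pderiv (F (ind (k @ [a]))) = (if a = 1 then F (ind k) else 0)"
    "is_index l \<Longrightarrow> 1 \<le> a \<Longrightarrow> pderiv (F (S (a # l))) = (if a = 1 then F (S l) else 0)" for k l a
    using dl_S[of "a # l"] by (simp_all add: pderiv_F dl_ind_snoc del: S.simps)
  \<comment> \<open>The two terms of the recursion coincide, because the empty index is the
    unit.\<close>
  have "H [] (a # l) = 0" for a l by (simp add: ind_Nil)
  then show "tele (\<lambda>k. F (ind k)) (\<lambda>l. F (S l)) [] (a # l) = 0" for a l
    using F_H[of "[]" "a # l"] \<open>F 0 = 0\<close> by metis
qed

end

text \<open>The analogue of the monomial symmetric function for the partition (i,1^n):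
  \<open>ee i\<close> runs through all positions among \<open>n\<close> ones.\<close>

primrec one_letter_sum :: "nat \<Rightarrow> nat \<Rightarrow> ncpoly" where
  "one_letter_sum i 0 = ee i"
| "one_letter_sum i (Suc n) = ee i * ind (replicate (Suc n) 1) + ee 1 * one_letter_sum i n"

text \<open>Either the entry \<open>i\<close> stays separate or it merges with one of the
  ones.\<close>

lemma harmonic_letter_ones:
  "1 \<le> i \<Longrightarrow> harmonic (ee i) (ind (replicate n 1)) =
     one_letter_sum i n + (case n of 0 \<Rightarrow> 0 | Suc n' \<Rightarrow> one_letter_sum (Suc i) n')"
proof (induction n)
  case 0
  have "ee i \<in> H1" using H1_closed(7)[of "[i]"] by (simp add: ind_def)
  then show ?case by (simp add: ind_Nil)
next
  case (Suc n)
  have e: "ee i = ind [i]" by (simp add: ind_def)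
  have idx: "is_index (replicate m 1)" for m by (simp add: is_index_def)
  have rec: "harmonic (ee i) (ind (replicate m 1)) = harmonic_ind [i] (replicate m 1)" for m
    using Suc.prems idx by (simp add: e harmonic_ind_ind del: replicate.simps)
  have step: "harmonic_ind [i] (replicate (Suc n) 1) = ee i * ind (replicate (Suc n) 1) +
      ee 1 * harmonic_ind [i] (replicate n 1) + ee (Suc i) * ind (replicate n 1)"
    by simp
  note IH = Suc.IH[OF Suc.prems, unfolded rec]
  show ?case
    unfolding rec step IH by (cases n) (simp_all add: ind_Nil distrib_left add_ac)
qed

text \<open>By \<open>harmonic_letter_ones\<close> consecutive terms share a summand, and the signs
  cancel it. For \<open>i = 1\<close>, with \<open>one_letter_sum_1\<close>, this is Newton's
  identity, in which \<open>ee\<close> corresponds to power sums and (1,...,1) to elementary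
  symmetric functions.\<close>

lemma newton_telescope:
  "1 \<le> i \<Longrightarrow> (\<Sum>j\<le>n. qsc ((-1) ^ j) (harmonic (ee (i + j)) (ind (replicate (n - j) 1)))) =
     one_letter_sum i n"
proof (induction n arbitrary: i)
  case 0
  then show ?case using harmonic_letter_ones[of i 0] by simp
next
  case (Suc n)
  have "(\<Sum>j\<le>Suc n. qsc ((-1) ^ j) (harmonic (ee (i + j)) (ind (replicate (Suc n - j) 1)))) =
      harmonic (ee i) (ind (replicate (Suc n) 1)) +
      (\<Sum>j\<le>n. qsc (-1) (qsc ((-1) ^ j) (harmonic (ee (Suc i + j)) (ind (replicate (n - j) 1)))))"
    unfolding sum.atMost_Suc_shift by simp
  also have "\<dots> = harmonic (ee i) (ind (replicate (Suc n) 1)) - one_letter_sum (Suc i) n"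
    unfolding qsc_sum[symmetric] using Suc.IH[of "Suc i"] by (simp add: uminus_eq_qsc[symmetric])
  finally show ?case using harmonic_letter_ones[of i "Suc n"] Suc.prems by simp
qed

lemma one_letter_sum_1: "one_letter_sum 1 n = qsc (of_nat (Suc n)) (ind (replicate (Suc n) 1))"
proof (induction n)
  case (Suc n)
  show ?case
    using qsc_add_left[of "of_nat (Suc n)" 1 "ind (replicate (Suc (Suc n)) 1)"] Suc
    by (simp add: ind_Cons add_ac)
qed (simp add: ind_def)

lemma shuffle_letter_ones:
  "shuffle_word [a] (replicate n a) = qsc (of_nat (Suc n)) (wd (replicate (Suc n) a))"
proof (induction n)
  case (Suc n)
  then show ?case
    using qsc_add_left[of "of_nat (Suc n)" 1 "wd (replicate (Suc (Suc n)) a)"]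
    by (simp add: wd_mult add_ac)
qed simp

lemma fps_linear_ode:
  fixes V :: "real poly fps"
  assumes "fps_deriv V = V * fps_const [:0, 1:]" "fps_nth V 0 = 1"
  shows "fps_nth V n = monom (1 / fact n) n"
proof (induction n)
  case 0
  then show ?case using assms by (simp add: monom_0)
next
  case (Suc n)
  have "of_nat (Suc n) * fps_nth V (Suc n) = fps_nth V n * [:0, 1:]"
    using arg_cong[OF assms(1), of "\<lambda>f. fps_nth f n"] by simp
  also have "\<dots> = monom (1 / fact n) (Suc n)"
    unfolding Suc by (simp add: monom_Suc)
  also have "\<dots> = of_nat (Suc n) * monom (1 / fact (Suc n)) (Suc n)"
    by (simp add: of_nat_poly smult_monom del: of_nat_Suc)
  finally show ?case by (simp del: of_nat_Suc)
qed

definition fps_lift :: "real fps \<Rightarrow> real poly fps" where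
  "fps_lift f = Abs_fps (\<lambda>n. [:fps_nth f n:])"

lemma fps_lift_mult: "fps_lift (f * g) = fps_lift f * fps_lift g"
proof (rule fps_ext)
  fix n
  have "(\<Sum>i\<in>I. [:h i:]) = [:sum h I:]" for h :: "nat \<Rightarrow> real" and I
    by (induction I rule: infinite_finite_induct) simp_all
  then show "fps_nth (fps_lift (f * g)) n = fps_nth (fps_lift f * fps_lift g) n"
    by (simp add: fps_lift_def fps_mult_nth, intro sum.cong refl mult.commute)
qed

lemma fps_lift_deriv: "fps_deriv (fps_lift f) = fps_lift (fps_deriv f)"
  by (rule fps_ext) (simp add: fps_lift_def of_nat_poly del: of_nat_Suc)

lemma A_series_0: "fps_nth (A_series Z) 0 = 1"
  by (simp add: A_series_def)

lemma A_series_deriv: "fps_deriv (A_series Z) =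
    A_series Z * Abs_fps (\<lambda>n. if n = 0 then 0 else (-1) ^ Suc n * Z (ee (Suc n)))"
proof -
  let ?g = "Abs_fps (\<lambda>n. if 2 \<le> n then (-1) ^ n / of_nat n * Z (ee n) else 0)"
  have "fps_deriv (A_series Z) = (fps_deriv (fps_exp 1) oo ?g) * fps_deriv ?g"
    unfolding A_series_def by (rule fps_compose_deriv) simp
  also have "fps_deriv (fps_exp (1::real)) oo ?g = A_series Z"
    by (simp add: A_series_def)
  also have "fps_deriv ?g = Abs_fps (\<lambda>n. if n = 0 then 0 else (-1) ^ Suc n * Z (ee (Suc n)))"
    by (rule fps_ext) (simp del: of_nat_Suc power_Suc)
  finally show ?thesis .
qed

lemma A_series_inverse: "(A_series Z oo (- fps_X)) * inverse (A_series Z oo (- fps_X)) = 1"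
  by (rule inverse_mult_eq_1') (simp add: A_series_0)

lemma sum_H1: "(\<And>j. j \<in> J \<Longrightarrow> g j \<in> H1) \<Longrightarrow> sum g J \<in> H1"
  by (induction J rule: infinite_finite_induct) auto

context regularizable_character
begin

lemma F_sum: "(\<And>j. j \<in> J \<Longrightarrow> g j \<in> H1) \<Longrightarrow> F (sum g J) = (\<Sum>j\<in>J. F (g j))"
proof (induction J rule: infinite_finite_induct)
  case (insert j J)
  then show ?case by (simp add: F_add sum_H1)
qed (use F_H0[of 0] in \<open>simp_all add: Z_zero\<close>)

end

text \<open>The shuffle of \<open>e_1\<close> with the word of \<open>m\<close> letters
  \<open>e_1\<close> is \<open>m + 1\<close> times the next such word, so these words are divided
  powers of T.\<close>

lemma shuffle_F_ones:
  assumes "regularizable_character shuffle Z"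
  shows "regularizable_character.F shuffle Z (ind (replicate m 1)) = monom (1 / fact m) m"
proof -
  interpret regularizable_character shuffle Z by fact
  have ind: "ind (replicate m 1) = wd (replicate m E1)" for m
    by (induction m) (simp_all add: ind_Nil wd_Nil ind_Cons ee_1 wd_mult)
  have H1: "wd (replicate m E1) \<in> H1" for m by (cases m) (simp_all add: wd_H1)
  show ?thesis
  proof (induction m)
    case 0
    then show ?case using F_H0[of 1] by (simp add: ind_Nil Z_one monom_0)
  next
    case (Suc m)
    have "[:0, 1:] * F (wd (replicate m E1)) = F (shuffle (wd [E1]) (wd (replicate m E1)))"
      using H1[of m] by (simp add: F_mult F_x)
    also have "\<dots> = smult (of_nat (Suc m)) (F (wd (replicate (Suc m) E1)))"
      using H1[of "Suc m"]
      by (simp add: shuffle_wd shuffle_letter_ones F_qsc del: of_nat_Suc replicate.simps)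
    finally have "smult (1 / of_nat (Suc m)) (monom (1 / fact m) (Suc m)) =
        smult (1 / of_nat (Suc m)) (smult (of_nat (Suc m)) (F (wd (replicate (Suc m) E1))))"
      unfolding Suc[unfolded ind] monom_Suc by (simp del: of_nat_Suc replicate.simps)
    then show ?case unfolding ind by (simp add: smult_monom del: of_nat_Suc replicate.simps)
  qed
qed

text \<open>Let U be the generating function of the values at (1,...,1) and A the series
  \<open>A_series Z\<close>. Newton's identity says U' = U G, and A' = A h because A is an
  exponential. As h + G = T, the product A U solves the equation of exp(Tu). Each \<open>D\<close>
  removes a one, so A(D) applied to the m-th value gives the m-th coefficient of A U.\<close>

lemma rho_harmonic_F_ones:
  assumes "regularizable_character harmonic Z"
  shows "rho_of (A_series Z) (regularizable_character.F harmonic Z (ind (replicate m 1))) =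
    monom (1 / fact m) m"
proof -
  interpret regularizable_character harmonic Z by fact
  interpret tele_pair "\<lambda>k. F (ind k)" "\<lambda>l. F (har.S l)" by (rule tele_pair_F)
  define U where "U = Abs_fps (\<lambda>m. F (ind (replicate m 1)))"
  define G where "G = Abs_fps (\<lambda>j. smult ((-1) ^ j) (F (ee (Suc j))))"
  have ee_H1: "ee j \<in> H1" for j using H1_closed(7)[of "[j]"] by (simp add: ind_def)
  have U_deriv: "fps_deriv U = U * G"
  proof (rule fps_ext)
    fix m
    have "of_nat (Suc m) * fps_nth U (Suc m) = F (qsc (of_nat (Suc m)) (ind (replicate (Suc m) 1)))"
      by (simp add: U_def F_qsc of_nat_poly del: of_nat_Suc replicate.simps)
    also have "\<dots> = F (\<Sum>j\<le>m. qsc ((-1) ^ j) (harmonic (ee (1 + j)) (ind (replicate (m - j) 1))))"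
      unfolding one_letter_sum_1[symmetric] by (subst newton_telescope) simp_all
    also have "\<dots> = (\<Sum>j\<le>m. fps_nth G j * fps_nth U (m - j))"
      by (subst F_sum) (auto simp: harmonic_H1 ee_H1 F_qsc F_mult G_def U_def of_rat_power of_rat_minus)
    finally show "fps_nth (fps_deriv U) m = fps_nth (U * G) m"
      by (simp add: fps_mult_nth atLeast0AtMost mult.commute[of U] del: of_nat_Suc)
  qed
  let ?h = "Abs_fps (\<lambda>n. if n = 0 then 0 else (-1) ^ Suc n * Z (ee (Suc n)))"
  \<comment> \<open>The constant coefficient of \<open>G\<close> is the value T at
    \<open>e_1\<close>. The later ones are values of \<open>Z\<close> at admissible letters, which
    the signs in \<open>A_series\<close> make cancel.\<close>
  have hG: "fps_lift ?h + G = fps_const [:0, 1:]"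
  proof (rule fps_ext)
    fix j
    have "ee (Suc j) \<in> H0" if "j \<noteq> 0"
      using that ee_H1 dl_mult_ee[of "Suc j" 1] by (simp add: H0_iff_dl)
    then show "fps_nth (fps_lift ?h + G) j = fps_nth (fps_const [:0, 1:]) j"
      by (cases "j = 0") (simp_all add: fps_lift_def G_def F_H0 ee_1 F_x)
  qed
  define V where "V = fps_lift (A_series Z) * U"
  have "fps_deriv V = V * (fps_lift ?h + G)"
    unfolding V_def fps_deriv_mult fps_lift_deriv A_series_deriv[of Z] fps_lift_mult U_deriv
    by (simp add: algebra_simps)
  then have "fps_deriv V = V * fps_const [:0, 1:]" unfolding hG .
  moreover have "fps_nth V 0 = 1"
    using n_Nil by (simp add: V_def U_def fps_lift_def A_series_0)
  ultimately have V: "fps_nth V m = monom (1 / fact m) m" by (rule fps_linear_ode)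
  have idx: "is_index (replicate m 1)" for m by (simp add: is_index_def)
  have D: "(pderiv ^^ i) (F (ind (replicate m 1))) = F (ind (replicate (m - i) 1))" if "i \<le> m" for i
    using that
  proof (induction i)
    case (Suc i)
    then obtain m' where m': "m - i = Suc m'" by (metis Suc_diff_Suc Suc_le_lessD)
    have "pderiv (F (ind (replicate m' 1 @ [1]))) = F (ind (replicate m' 1))"
      using pderiv_n[OF idx[of m'], of 1] by simp
    moreover have "m - Suc i = m'" using m' by simp
    ultimately show ?case using Suc m' by (simp add: replicate_append_same)
  qed simp
  have "degree (F (ind (replicate m 1))) \<le> m" using degree_n[OF idx[of m]] by simp
  then have "rho_of (A_series Z) (F (ind (replicate m 1))) =
      (\<Sum>i\<le>m. smult (fps_nth (A_series Z) i) (F (ind (replicate (m - i) 1))))"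
    unfolding rho_of_eq_sum[OF \<open>degree _ \<le> m\<close>] by (intro sum.cong refl) (simp only: atMost_iff D)
  also have "\<dots> = fps_nth V m"
    by (simp add: V_def fps_mult_nth fps_lift_def U_def atLeast0AtMost)
  finally show ?thesis using V by simp
qed

text \<open>The sum of the two last entries ranges over all \<open>e\<close> with
  \<open>2 \<le> e\<close>, and every such \<open>e\<close> is already reached with last entry 1 in
  the second index.\<close>

lemma Int_Ser_iff:
  "Int_Ser Z \<longleftrightarrow> (\<forall>k e l. is_index k \<and> 2 \<le> e \<and> is_index l \<longrightarrow>
     Z (sh.H (k @ [e]) l) = Z (har.H (k @ [e]) l))"
proof
  assume I: "Int_Ser Z"
  show "\<forall>k e l. is_index k \<and> 2 \<le> e \<and> is_index l \<longrightarrow> Z (sh.H (k @ [e]) l) = Z (har.H (k @ [e]) l)"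
  proof (intro allI impI, elim conjE)
    fix k e l assume kel: "is_index k" "(2::nat) \<le> e" "is_index l"
    then have "Z (mu (k @ [e - 1]) (rev l @ [1])) =
        Z (circledast (ind (k @ [e - 1])) (star (rev l @ [1])))"
      using I by (simp add: Int_Ser_def)
    then show "Z (sh.H (k @ [e]) l) = Z (har.H (k @ [e]) l)"
      using mu_eq_H[of k "e - 1" 1 "rev l"] circledast_star[of k "e - 1" 1 "rev l"] kel by simp
  qed
next
  assume I: "\<forall>k e l. is_index k \<and> 2 \<le> e \<and> is_index l \<longrightarrow>
    Z (sh.H (k @ [e]) l) = Z (har.H (k @ [e]) l)"
  show "Int_Ser Z"
    unfolding Int_Ser_def
  proof (intro allI impI, elim conjE)
    fix k l assume kl: "is_index k" "is_index l" "k \<noteq> []" "l \<noteq> []"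
    then obtain k' c l' d where kl': "k = k' @ [c]" "l = l' @ [d]" by (meson rev_exhaust)
    then have "is_index k'" "1 \<le> c" "is_index l'" "1 \<le> d" using kl by auto
    then show "Z (mu k l) = Z (circledast (ind k) (star l))"
      using I mu_eq_H[of k' c d l'] circledast_star[of k' c d l'] unfolding kl' by simp
  qed
qed

theorem theorem4p6:
  fixes Z :: "ncpoly \<Rightarrow> real"
  assumes "Q_linear_on_H0 Z"
    and "double_shuffle Z"
  shows "(Reg Z \<longleftrightarrow> Reg_star Z) \<and> (Reg_star Z \<longleftrightarrow> Int_Ser Z)"
proof -
  have Z_add: "Z (p + q) = Z p + Z q" and Z_qsc: "Z (qsc c p) = of_rat c * Z p"
    and Z_har: "Z (harmonic p q) = Z p * Z q" and Z_sh: "Z (shuffle p q) = Z p * Z q"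
    if "p \<in> H0" "q \<in> H0" for p q c
    using assms that by (auto simp: Q_linear_on_H0_def double_shuffle_def)
  have "Z 1 = Z 1 * Z 1" using Z_sh[of 1 1] by simp
  then consider "Z 1 = 0" | "Z 1 = 1" by auto
  then show ?thesis
  proof cases
    case 1
    \<comment> \<open>In this degenerate case both regularizations are the default 0 and
      \<open>Z\<close> vanishes on \<open>H0\<close>, so all three properties hold.\<close>
    then have Z0: "Z p = 0" if "p \<in> H0" for p using Z_sh[of p 1] that by simp
    have "\<not> is_regularization m Z f" for m f
    proof
      assume "is_regularization m Z f"
      then have "f 1 = 1" "f 1 = [:Z 1:]" using H0_closed(2) unfolding is_regularization_def by blast+
      then show False using 1 by simp
    qed
    then have "regularization m Z = (\<lambda>_. 0)" for m by (simp add: regularization_def)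
    then have "Reg Z" "Reg_star Z"
      by (simp_all add: Reg_def Reg_star_def Z_sh_star_def Z_har_star_def Z_sh_def Z_har_def
          rho_def rho_star_def)
    moreover have "Int_Ser Z"
      unfolding Int_Ser_iff by (simp add: Z0 sh.H_admissible_H0 har.H_admissible_H0)
    ultimately show ?thesis by simp
  next
    case 2
    interpret s: regularizable_character shuffle Z
      by unfold_locales (simp_all add: Z_add Z_qsc[OF _ H0_closed(1)] Z_sh 2)
    interpret h: regularizable_character harmonic Z
      by unfold_locales (simp_all add: Z_add Z_qsc[OF _ H0_closed(1)] Z_har 2)
    let ?a = "A_series Z" and ?b = "inverse (A_series Z oo (- fps_X))"
    interpret c: tele_comparison "\<lambda>k. h.F (ind k)" "\<lambda>l. h.F (har.S l)"
      "\<lambda>k. s.F (ind k)" "\<lambda>l. s.F (sh.S l)" ?a ?b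
    proof (intro tele_comparison.intro h.tele_pair_F s.tele_pair_F tele_comparison_axioms.intro
        A_series_0 A_series_inverse)
      show "s.F (ind (replicate m 1)) = rho_of ?a (h.F (ind (replicate m 1)))" for m
        unfolding shuffle_F_ones[OF s.regularizable_character_axioms]
          rho_harmonic_F_ones[OF h.regularizable_character_axioms] ..
    qed
    have sh: "Z_sh Z p = s.F p" and har: "Z_har Z p = h.F p" if "p \<in> H1" for p
      using that by (simp_all add: Z_sh_def Z_har_def s.regularization_eq h.regularization_eq)
    have "Reg Z \<longleftrightarrow> c.reg_nonstar"
      by (simp add: Reg_def c.reg_nonstar_def sh har rho_def)
    moreover have "Reg_star Z \<longleftrightarrow> c.reg_star"
    proof -
      \<comment> \<open>\<open>S\<close> takes its index in reversed order, and reversal permutes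
        the indices.\<close>
      have "Reg_star Z \<longleftrightarrow> (\<forall>k. is_index (rev k) \<longrightarrow> s.F (sh.S (rev k)) = rho_of ?b (h.F (har.S (rev k))))"
        by (simp add: Reg_star_def Z_sh_star_def Z_har_star_def rho_star_def W_P_eq_S star_eq_S sh har)
      then show ?thesis unfolding c.reg_star_def by (metis rev_rev_ident)
    qed
    moreover have "Int_Ser Z \<longleftrightarrow> c.tele_agree"
    proof -
      \<comment> \<open>On \<open>H0\<close> both regularizations are constant polynomials, so
        comparing them amounts to comparing values of \<open>Z\<close>.\<close>
      have "Z (sh.H (k @ [e]) l) = Z (har.H (k @ [e]) l) \<longleftrightarrow>
          s.F (sh.H (k @ [e]) l) = h.F (har.H (k @ [e]) l)" if "2 \<le> e" "is_index l" for k e l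
        using that by (simp add: s.F_H0 h.F_H0 sh.H_admissible_H0 har.H_admissible_H0)
      then show ?thesis
        unfolding Int_Ser_iff c.tele_agree_def s.F_H[symmetric] h.F_H[symmetric] by auto
    qed
    ultimately show ?thesis
      using c.reg_nonstar_iff_reg_star c.reg_nonstar_imp_tele_agree c.tele_agree_imp_reg_nonstar
      by blast
  qed
qed

end
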